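(* Let $A\in\mathbb{R}^{n_x\times n_x}$, $B_u\in\mathbb{R}^{n_x\times n_u}$, $B_d\in\mathbb{R}^{n_x\times n_d}$, and symmetric $Q\in\mathbb{R}^{n_x\times n_x}$, $R\in\mathbb{R}^{n_u\times n_u}$ satisfy: (i) $Q\succeq 0$ and $R\succ 0$; (ii) $(A,B_u)$ is stabilizable; (iii) $A$ is nonsingular; (iv) $(A,Q)$ has no unobservable modes on the unit circle. Let $K_{nc}$ be the optimal non-causal controller, and let $\gamma_{nc}$ be the $H_\infty$ norm of the closed loop with $K_{nc}$, i.e. the minimal (infimal) $\gamma$ such that $J(K_{nc},d)<\gamma^2\|d\|_2^2$ for all nonzero $d\in\ell_2$. For each integer $p\ge 0$, let $\gamma_{\infty,p}$ be the optimal closed-loop $H_\infty$ norm achievable with $p$ steps of preview, i.e. the minimal (infimal) $\gamma>0$ for which there exists a stabilizing $p$-step preview controller $K_p$ with $J(K_p,d)<\gamma^2\|d\|_2^2$ for all nonzero $d\in\ell_2$. Then $$\lim_{p\to\infty}\gamma_{\infty,p}=\gamma_{nc}.$$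
   Context: Plant: $x(t+1)=Ax(t)+B_d d(t)+B_u u(t)$, $t=0,1,2,\dots$, with state $x(t)\in\mathbb{R}^{n_x}$, disturbance $d(t)\in\mathbb{R}^{n_d}$, control input $u(t)\in\mathbb{R}^{n_u}$. Here $\ell_2$ is the space of square-summable sequences $d=(d(t))_{t\ge0}$ and $\|d\|_2^2=\sum_{t\ge 0}\|d(t)\|^2$. Cost: for a controller $K$ and $d\in\ell_2$, with initial condition $x(0)=0$, $J(K,d)=\sum_{t=0}^\infty \left( x(t)^\top Qx(t)+u(t)^\top Ru(t)\right)$, where $x,u$ are the closed-loop trajectories generated by $K$ and $d$. A $p$-step preview controller ($p\ge 0$) is a controller whose input at time $t$ is the information $i_p(t)=\{x(t),d(t),\dots,d(t+p)\}$ and whose output is $u(t)$; thus $u(t)$ depends only on information received up to time $t$. A controller is stabilizing if the closed loop is stable; in particular, for every initial condition and every $d\in\ell_2$ the closed-loop signals $x$ and $u$ are in $\ell_2$. Optimal non-causal controller: under (i)–(iv) there is a unique stabilizing solution $X\succeq 0$ of the discrete-time algebraic Riccati equation $0=X-A^\top XA-Q+A^\top XB_u(R+B_u^\top XB_u)^{-1}B_u^\top XA$. "Stabilizing" means that $\tilde A:=A-B_uK_x$ is Schur (all eigenvalues in the open unit disk), where $K_x:=(R+B_u^\top XB_u)^{-1}B_u^\top XA$. Let $K_v:=(R+B_u^\top XB_u)^{-1}B_u^\top$. The controller $K_{nc}$, which at time $t$ has access to $x(t)$ and $d(t),d(t+1),\dots$, is $$u_{nc}(t)=-K_xx(t)-K_v\sum_{j=t}^\infty(\tilde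 A^\top)^{j-t}XB_d\,d(j).$$ It is known that $J(K_{nc},d)\le J(K,d)$ for every stabilizing controller $K$ (possibly non-causal in $d$) and every $d\in\ell_2$. *)

theory Defs
  imports "HOL-Analysis.Analysis"
begin

definition psd :: "real^'n^'n \<Rightarrow> bool" where
  "psd M \<longleftrightarrow> transpose M = M \<and> (\<forall>x. 0 \<le> x \<bullet> (M *v x))"

definition pd :: "real^'n^'n \<Rightarrow> bool" where
  "pd M \<longleftrightarrow> transpose M = M \<and> (\<forall>x. x \<noteq> 0 \<longrightarrow> 0 < x \<bullet> (M *v x))"

definition complex_mat :: "real^'n^'m \<Rightarrow> complex^'n^'m" where
  "complex_mat M = (\<chi> i j. complex_of_real (M $ i $ j))"

definition eigenpair :: "real^'n^'n \<Rightarrow> complex \<Rightarrow> complex^'n \<Rightarrow> bool" where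
  "eigenpair M z v \<longleftrightarrow> v \<noteq> 0 \<and> complex_mat M *v v = z *s v"

definition schur :: "real^'n^'n \<Rightarrow> bool" where
  "schur M \<longleftrightarrow> (\<forall>z. (\<exists>v. eigenpair M z v) \<longrightarrow> cmod z < 1)"

definition stabilizable :: "real^'x^'x \<Rightarrow> real^'u^'x \<Rightarrow> bool" where
  "stabilizable A B \<longleftrightarrow> (\<exists>F. schur (A - B ** F))"

text \<open>An eigenvalue is an unobservable mode if some eigenvector for it is
  invisible at the output.\<close>

definition unobservable_mode :: "real^'x^'x \<Rightarrow> real^'x^'y \<Rightarrow> complex \<Rightarrow> bool" where
  "unobservable_mode A C z \<longleftrightarrow> (\<exists>v. eigenpair A z v \<and> complex_mat C *v v = 0)"

definition l2 :: "(nat \<Rightarrow> real^'n) \<Rightarrow> bool" where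
  "l2 d \<longleftrightarrow> summable (\<lambda>t. (norm (d t))\<^sup>2)"

definition l2_norm_sq :: "(nat \<Rightarrow> real^'n) \<Rightarrow> real" where
  "l2_norm_sq d = (\<Sum>t. (norm (d t))\<^sup>2)"

text \<open>A controller maps the state history \<open>[x(0), \<dots>, x(t)]\<close> and the disturbance to
  the input \<open>u(t)\<close>; the time is one less than the length of the history. It is always
  causal in the state, but a priori unrestricted in its use of the disturbance. It
  may be nonlinear, time-varying and have memory.\<close>

type_synonym ('x, 'u, 'd) controller =
  "(real^'x) list \<Rightarrow> (nat \<Rightarrow> real^'d) \<Rightarrow> real^'u"

text \<open>Together, the data \<open>x(s), d(s), \<dots>, d(s + p)\<close> received at the times \<open>s \<le> t\<close>
  are the state history up to \<open>t\<close> and the values \<open>d(0), \<dots>, d(t + p)\<close>. With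
  \<open>length xs = t + 1\<close>, the condition \<open>s \<le> t + p\<close> reads \<open>s < length xs + p\<close>.\<close>

definition preview_controller :: "nat \<Rightarrow> ('x, 'u, 'd) controller \<Rightarrow> bool" where
  "preview_controller p K \<longleftrightarrow>
     (\<forall>xs d d'. xs \<noteq> [] \<and> (\<forall>s < length xs + p. d s = d' s) \<longrightarrow> K xs d = K xs d')"

primrec state_history ::
  "real^'x^'x \<Rightarrow> real^'u^'x \<Rightarrow> real^'d^'x \<Rightarrow> ('x, 'u, 'd) controller \<Rightarrow>
   real^'x \<Rightarrow> (nat \<Rightarrow> real^'d) \<Rightarrow> nat \<Rightarrow> (real^'x) list" where
  "state_history A Bu Bd K x0 d 0 = [x0]"
| "state_history A Bu Bd K x0 d (Suc t) =
     (let xs = state_history A Bu Bd K x0 d t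
      in xs @ [A *v last xs + Bd *v d t + Bu *v K xs d])"

definition cl_state ::
  "real^'x^'x \<Rightarrow> real^'u^'x \<Rightarrow> real^'d^'x \<Rightarrow> ('x, 'u, 'd) controller \<Rightarrow>
   real^'x \<Rightarrow> (nat \<Rightarrow> real^'d) \<Rightarrow> nat \<Rightarrow> real^'x" where
  "cl_state A Bu Bd K x0 d t = last (state_history A Bu Bd K x0 d t)"

definition cl_input ::
  "real^'x^'x \<Rightarrow> real^'u^'x \<Rightarrow> real^'d^'x \<Rightarrow> ('x, 'u, 'd) controller \<Rightarrow>
   real^'x \<Rightarrow> (nat \<Rightarrow> real^'d) \<Rightarrow> nat \<Rightarrow> real^'u" where
  "cl_input A Bu Bd K x0 d t = K (state_history A Bu Bd K x0 d t) d"

definition stabilizing ::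
  "real^'x^'x \<Rightarrow> real^'u^'x \<Rightarrow> real^'d^'x \<Rightarrow> ('x, 'u, 'd) controller \<Rightarrow> bool" where
  "stabilizing A Bu Bd K \<longleftrightarrow>
     (\<forall>x0 d. l2 d \<longrightarrow> l2 (cl_state A Bu Bd K x0 d) \<and> l2 (cl_input A Bu Bd K x0 d))"

text \<open>Since \<open>\<Sum>\<close> is total, the cost is meaningful only where the series converges,
  in particular for stabilizing controllers and \<open>l2 d\<close>.\<close>

definition cost ::
  "real^'x^'x \<Rightarrow> real^'u^'x \<Rightarrow> real^'d^'x \<Rightarrow> real^'x^'x \<Rightarrow> real^'u^'u \<Rightarrow>
   ('x, 'u, 'd) controller \<Rightarrow> (nat \<Rightarrow> real^'d) \<Rightarrow> real" where
  "cost A Bu Bd Q R K d =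
     (\<Sum>t. cl_state A Bu Bd K 0 d t \<bullet> (Q *v cl_state A Bu Bd K 0 d t)
         + cl_input A Bu Bd K 0 d t \<bullet> (R *v cl_input A Bu Bd K 0 d t))"

definition hinf_bound ::
  "real^'x^'x \<Rightarrow> real^'u^'x \<Rightarrow> real^'d^'x \<Rightarrow> real^'x^'x \<Rightarrow> real^'u^'u \<Rightarrow>
   ('x, 'u, 'd) controller \<Rightarrow> real \<Rightarrow> bool" where
  "hinf_bound A Bu Bd Q R K \<gamma> \<longleftrightarrow>
     (\<forall>d. l2 d \<and> d \<noteq> (\<lambda>t. 0) \<longrightarrow> cost A Bu Bd Q R K d < \<gamma>\<^sup>2 * l2_norm_sq d)"

definition gain_x ::
  "real^'x^'x \<Rightarrow> real^'u^'x \<Rightarrow> real^'u^'u \<Rightarrow> real^'x^'x \<Rightarrow> real^'x^'u" where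
  "gain_x A Bu R X =
     matrix_inv (R + transpose Bu ** X ** Bu) ** transpose Bu ** X ** A"

definition gain_v ::
  "real^'u^'x \<Rightarrow> real^'u^'u \<Rightarrow> real^'x^'x \<Rightarrow> real^'x^'u" where
  "gain_v Bu R X = matrix_inv (R + transpose Bu ** X ** Bu) ** transpose Bu"

definition stabilizing_dare_solution ::
  "real^'x^'x \<Rightarrow> real^'u^'x \<Rightarrow> real^'x^'x \<Rightarrow> real^'u^'u \<Rightarrow> real^'x^'x \<Rightarrow> bool" where
  "stabilizing_dare_solution A Bu Q R X \<longleftrightarrow>
     psd X \<and>
     0 = X - transpose A ** X ** A - Q
         + transpose A ** X ** Bu ** matrix_inv (R + transpose Bu ** X ** Bu)
           ** transpose Bu ** X ** A \<and>
     schur (A - Bu ** gain_x A Bu R X)"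

definition dare_X ::
  "real^'x^'x \<Rightarrow> real^'u^'x \<Rightarrow> real^'x^'x \<Rightarrow> real^'u^'u \<Rightarrow> real^'x^'x" where
  "dare_X A Bu Q R = (THE X. stabilizing_dare_solution A Bu Q R X)"

text \<open>The sum over \<open>j \<ge> t\<close> is indexed by \<open>k = j - t\<close>, and the \<open>k\<close>-th matrix power
  is written as a \<open>k\<close>-fold application.\<close>

definition K_nc ::
  "real^'x^'x \<Rightarrow> real^'u^'x \<Rightarrow> real^'d^'x \<Rightarrow> real^'x^'x \<Rightarrow> real^'u^'u \<Rightarrow>
   ('x, 'u, 'd) controller" where
  "K_nc A Bu Bd Q R = (\<lambda>xs d.
     let X = dare_X A Bu Q R;
         Kx = gain_x A Bu R X;
         Kv = gain_v Bu R X;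
         At = A - Bu ** Kx;
         t = length xs - 1
     in - (Kx *v last xs)
        - Kv *v (\<Sum>k. (((*v) (transpose At)) ^^ k) (X *v (Bd *v d (t + k)))))"

text \<open>Only positive \<open>\<gamma>\<close> are admitted: as \<open>hinf_bound\<close> depends on \<open>\<gamma>\<^sup>2\<close> alone, the
  infimum over all reals would be meaningless.\<close>

definition \<gamma>_nc ::
  "real^'x^'x \<Rightarrow> real^'u^'x \<Rightarrow> real^'d^'x \<Rightarrow> real^'x^'x \<Rightarrow> real^'u^'u \<Rightarrow> real" where
  "\<gamma>_nc A Bu Bd Q R = Inf {\<gamma>. 0 < \<gamma> \<and> hinf_bound A Bu Bd Q R (K_nc A Bu Bd Q R) \<gamma>}"

definition \<gamma>_preview ::
  "real^'x^'x \<Rightarrow> real^'u^'x \<Rightarrow> real^'d^'x \<Rightarrow> real^'x^'x \<Rightarrow> real^'u^'u \<Rightarrow> nat \<Rightarrow> real" where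
  "\<gamma>_preview A Bu Bd Q R p =
     Inf {\<gamma>. 0 < \<gamma> \<and>
       (\<exists>K. preview_controller p K \<and> stabilizing A Bu Bd K \<and> hinf_bound A Bu Bd Q R K \<gamma>)}"

end

theory Submission
  imports Defs "HOL-Complex_Analysis.Great_Picard"
    "HOL-Computational_Algebra.Fundamental_Theorem_Algebra"
begin

(* Both formal power series and vectors use the infix $ for coefficients. *)
unbundle no fps_syntax

(* The simp rule trades transpose M *v x for x v* M, which lemmas about *v do not match. *)
declare transpose_matrix_vector [simp del]

text \<open>
  The non-causal controller is a state feedback plus a feedforward term driven by the
  costate \<open>g(t) = \<Sum>\<^sub>k (At\<^sup>T)\<^sup>k X Bd d(t + k)\<close>, where \<open>At\<close> is the closed-loop matrix. Because
  \<open>At\<close> is Schur, the weight of \<open>d(t + k)\<close> in \<open>g(t)\<close> decays geometrically in \<open>k\<close>. Cutting the sum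
  off after the term \<open>k = p\<close> gives a controller with \<open>p\<close> steps of preview, and the theorem
  holds because its cost exceeds the non-causal one by at most \<open>(E \<rho>\<^sup>p)\<^sup>2 \<parallel>d\<parallel>\<^sup>2\<close> with
  \<open>\<rho> < 1\<close>.

  The comparison of costs rests on one identity, \<open>cost_decomposition\<close>. Completing the square
  with the Riccati equation along any square-summable trajectory that starts at \<open>0\<close> gives
  \<open>J = \<Sum>\<^sub>t e(t)\<^sup>T H e(t) + \<Sum>\<^sub>t c(t)\<close>, where \<open>H\<close> is positive definite, \<open>e\<close> is the deviation of
  the input from the non-causal law and \<open>c\<close> depends on the disturbance alone. Thus
  the non-causal controller has \<open>e = 0\<close> and is optimal for every single disturbance, which
  yields \<open>\<gamma>_nc \<le> \<gamma>_preview p\<close> (\<open>unavoidable_cost_le\<close>); and for the truncated controller \<open>e(t)\<close> is the gain \<open>Kv\<close>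
  applied to the tail \<open>(At\<^sup>T)\<^sup>p\<^sup>+\<^sup>1 g(t + p + 1)\<close>, which yields
  \<open>\<gamma>_preview p \<le> \<gamma>_nc + E \<rho>\<^sup>p\<close> (\<open>preview_cost_bound\<close>). Both infima range over nonempty sets since
  \<open>\<Sum>\<^sub>t c(t)\<close> is bounded by a multiple of \<open>\<parallel>d\<parallel>\<^sup>2\<close>.

  The feedback matrix is defined through the stabilizing Riccati solution, so that existence
  and uniqueness of this solution have to be proved too. For existence (\<open>stabilizing_dare_solution_exists\<close>), iterate the Riccati map
  with state weights \<open>Q + I/(k + 1)\<close>, starting from the cost matrix of some stabilizing
  feedback. The iterates decrease, hence converge to a positive semidefinite fixed point \<open>X\<close>
  of the Riccati map for \<open>Q\<close>. The extra weight \<open>I/(k + 1)\<close> makes the closed loop of every iterate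
  Schur, so by Hurwitz' theorem the closed loop of \<open>X\<close> has no eigenvalue outside the closed unit
  disk, and an eigenvalue on the unit circle would be an unobservable mode of \<open>(A, Q)\<close>.
\<close>

section \<open>Geometric decay of the powers of a Schur matrix\<close>

definition poly_apply :: "complex poly \<Rightarrow> complex^'n^'n \<Rightarrow> complex^'n \<Rightarrow> complex^'n" where
  "poly_apply p N v = (\<Sum>i\<le>degree p. coeff p i *s (((*v) N ^^ i) v))"

lemma funpow_matrix_diff:
  fixes N :: "complex^'n^'n"
  shows "((*v) N ^^ k) (u - v) = ((*v) N ^^ k) u - ((*v) N ^^ k) v"
  by (induction k) (simp_all add: matrix_vector_mult_diff_distrib)

lemma funpow_matrix_smult:
  fixes N :: "complex^'n^'n"
  shows "((*v) N ^^ k) (z *s v) = z *s (((*v) N ^^ k) v)"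
  by (induction k) (simp_all add: vector_scalar_commute)

lemma poly_apply_upto:
  assumes "degree p \<le> m"
  shows "poly_apply p N v = (\<Sum>i\<le>m. coeff p i *s (((*v) N ^^ i) v))"
proof -
  have "(\<Sum>i\<le>m. coeff p i *s (((*v) N ^^ i) v)) = (\<Sum>i\<le>degree p. coeff p i *s (((*v) N ^^ i) v))"
    using assms by (intro sum.mono_neutral_right) (auto simp: coeff_eq_0)
  then show ?thesis by (simp add: poly_apply_def)
qed

lemma poly_apply_linear_factor:
  fixes N :: "complex^'n^'n"
  shows "poly_apply ([:-z, 1:] * q) N v = poly_apply q N (N *v v - z *s v)"
    and "poly_apply ([:-z, 1:] * q) N v = N *v poly_apply q N v - z *s poly_apply q N v"
proof -
  let ?T = "\<lambda>i. ((*v) N ^^ i) v"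
  have c: "coeff ([:-z, 1:] * q) i = (if i = 0 then 0 else coeff q (i - 1)) - z * coeff q i" for i
    by (cases i) (simp_all add: coeff_pCons)
  have d: "degree ([:-z, 1:] * q) \<le> Suc (degree q)"
    using degree_mult_le[of "[:-z, 1:]" q] by simp
  have "poly_apply ([:-z, 1:] * q) N v
     = (\<Sum>i\<le>Suc (degree q). (if i = 0 then 0 else coeff q (i - 1)) *s ?T i)
       - (\<Sum>i\<le>Suc (degree q). (z * coeff q i) *s ?T i)"
    unfolding poly_apply_upto[OF d] c
    by (simp only: vector_ssub_ldistrib vec.scale_left_diff_distrib sum_subtractf)
  also have "(\<Sum>i\<le>Suc (degree q). (if i = 0 then 0 else coeff q (i - 1)) *s ?T i)
      = (\<Sum>i\<le>degree q. coeff q i *s ?T (Suc i))"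
    by (subst sum.atMost_Suc_shift) simp
  also have "(\<Sum>i\<le>Suc (degree q). (z * coeff q i) *s ?T i) = z *s poly_apply q N v"
    by (simp add: poly_apply_def coeff_eq_0 vec.scale_sum_right)
  finally have e: "poly_apply ([:-z, 1:] * q) N v
      = (\<Sum>i\<le>degree q. coeff q i *s ?T (Suc i)) - z *s poly_apply q N v" .
  have "(\<Sum>i\<le>degree q. coeff q i *s ?T (Suc i)) = N *v poly_apply q N v"
    unfolding poly_apply_def vec.linear_sum[OF matrix_vector_mul_linear_gen]
    by (simp add: vector_scalar_commute)
  with e show "poly_apply ([:-z, 1:] * q) N v = N *v poly_apply q N v - z *s poly_apply q N v"
    by simp
  have "poly_apply q N (N *v v - z *s v)
     = (\<Sum>i\<le>degree q. coeff q i *s ?T (Suc i)) - z *s poly_apply q N v"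
    by (simp add: poly_apply_def funpow_matrix_diff funpow_matrix_smult funpow_swap1
        vec.scale_right_diff_distrib sum_subtractf vec.scale_sum_right mult.commute)
  with e show "poly_apply ([:-z, 1:] * q) N v = poly_apply q N (N *v v - z *s v)"
    by simp
qed

lemma norm_smult_vec:
  fixes v :: "complex^'n"
  shows "norm (z *s v) = cmod z * norm v"
  by (simp add: norm_vec_def norm_mult L2_set_right_distrib)

text \<open>Induction on the degree of \<open>p\<close>, splitting off one root \<open>z\<close> at a time. If \<open>z\<close> is
  not in the open unit disk then \<open>N - z\<close> is injective and the factor can be cancelled.
  Otherwise \<open>w = (N - z) v\<close> lies in the kernel of the cofactor and has decaying
  orbit, and \<open>N\<^sup>k\<^sup>+\<^sup>1 v = z N\<^sup>k v + N\<^sup>k w\<close> transfers the decay to \<open>v\<close>. The constants do not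
  depend on \<open>v\<close>, which makes the bound uniform.\<close>
lemma power_decay_on_kernel:
  fixes N :: "complex^'n^'n"
  assumes eig: "\<And>z v. v \<noteq> 0 \<Longrightarrow> N *v v = z *s v \<Longrightarrow> cmod z < 1"
    and "p \<noteq> 0"
  shows "\<exists>C \<rho>. 0 \<le> C \<and> 0 < \<rho> \<and> \<rho> < 1 \<and>
    (\<forall>v. poly_apply p N v = 0 \<longrightarrow> (\<forall>k. norm (((*v) N ^^ k) v) \<le> C * \<rho> ^ k * norm v))"
  using \<open>p \<noteq> 0\<close>
proof (induction "degree p" arbitrary: p)
  case 0
  then obtain c where "p = [:c:]" "c \<noteq> 0" by (metis degree_eq_zeroE pCons_0_0)
  then show ?case
    by (intro exI[of _ 0] exI[of _ "1/2"]) (auto simp: poly_apply_def funpow_matrix_smult[of _ _ 0, simplified])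
next
  case (Suc m)
  then obtain z where "poly p z = 0"
    using fundamental_theorem_of_algebra_alt[of p]
    by (metis degree_pCons_0 nat.distinct(1))
  then obtain q where p: "p = [:-z, 1:] * q" by (metis poly_eq_0_iff_dvd dvdE)
  have q0: "q \<noteq> 0" using p Suc.prems by auto
  have "degree p = Suc (degree q)" unfolding p using q0 by (subst degree_mult_eq) auto
  with Suc.hyps(2) have "m = degree q" by simp
  from Suc.hyps(1)[OF this q0] obtain C \<rho> where C: "0 \<le> C" "0 < \<rho>" "\<rho> < 1"
    and dec: "\<And>v k. poly_apply q N v = 0 \<Longrightarrow> norm (((*v) N ^^ k) v) \<le> C * \<rho> ^ k * norm v" by blast
  show ?case
  proof (cases "cmod z < 1")
    case False
    have "poly_apply q N v = 0" if "poly_apply p N v = 0" for v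
      using that eig[of "poly_apply q N v" z] False
      unfolding p poly_apply_linear_factor(2) by auto
    then show ?thesis using C dec by blast
  next
    case True
    define r where "r = (1 + max \<rho> (cmod z)) / 2"
    have r: "\<rho> \<le> r" "cmod z < r" "r < 1" "0 < r" using C True unfolding r_def by auto
    obtain L where L: "\<And>v. norm (N *v v) \<le> norm v * L" "0 \<le> L"
      using bounded_linear.nonneg_bounded[OF matrix_vector_mul_bounded_linear[of N]] by blast
    define C' where "C' = C * (L + 1)"
    \<comment> \<open>The bound \<open>D r\<^sup>k\<close> propagates along \<open>N\<^sup>k\<^sup>+\<^sup>1 v = z N\<^sup>k v + N\<^sup>k w\<close> if \<open>C' + \<bar>z\<bar> D \<le> r D\<close>.\<close>
    define D where "D = max 1 (C' / (r - cmod z))"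
    have CD: "C' \<le> D * (r - cmod z)" using r unfolding D_def
      by (metis diff_gt_0_iff_gt max.cobounded2 pos_divide_le_eq)
    have "norm (((*v) N ^^ k) v) \<le> D * r ^ k * norm v" if v: "poly_apply p N v = 0" for v k
    proof (induction k)
      case 0 then show ?case using mult_right_mono[of 1 D "norm v"] by (simp add: D_def)
    next
      case (Suc k)
      let ?w = "N *v v - z *s v"
      have w: "poly_apply q N ?w = 0" using v unfolding p poly_apply_linear_factor(1) .
      have "norm ?w \<le> norm v * L + cmod z * norm v"
        by (rule order_trans[OF norm_triangle_ineq4]) (simp add: L(1) norm_smult_vec add_mono)
      also have "\<dots> \<le> norm v * L + 1 * norm v"
        using True by (intro add_left_mono mult_right_mono) auto
      finally have nw: "norm ?w \<le> (L + 1) * norm v" by (simp add: algebra_simps)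
      have "norm (((*v) N ^^ k) ?w) \<le> C * \<rho> ^ k * norm ?w" using dec w by blast
      also have "\<dots> \<le> C * r ^ k * ((L + 1) * norm v)"
        using C r nw by (intro mult_mono power_mono) auto
      finally have a: "norm (((*v) N ^^ k) ?w) \<le> C' * (r ^ k * norm v)"
        by (simp add: C'_def algebra_simps)
      have "((*v) N ^^ Suc k) v = ((*v) N ^^ k) ?w + z *s ((*v) N ^^ k) v"
        by (simp add: funpow_matrix_diff funpow_matrix_smult funpow_swap1)
      then have "norm (((*v) N ^^ Suc k) v) \<le> C' * (r ^ k * norm v) + cmod z * (D * r ^ k * norm v)"
        using a Suc by (metis (no_types, lifting) norm_triangle_le add_mono norm_smult_vec mult_left_mono norm_ge_zero)
      also have "\<dots> \<le> D * (r - cmod z) * (r ^ k * norm v) + cmod z * (D * r ^ k * norm v)"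
        using CD r by (intro add_right_mono mult_right_mono) auto
      finally show ?case by (simp add: algebra_simps)
    qed
    then show ?thesis using r by (intro exI[of _ D] exI[of _ r]) (auto simp: D_def)
  qed
qed


text \<open>The space of matrices has finite dimension, so that the powers of \<open>N\<close> are linearly
  dependent.\<close>
lemma annihilating_poly_exists:
  fixes N :: "complex^'n^'n"
  shows "\<exists>p. p \<noteq> 0 \<and> (\<forall>v. poly_apply p N v = 0)"
proof -
  define \<phi> where "\<phi> k = matrix ((*v) N ^^ k)" for k
  have lin: "Vector_Spaces.linear (*s) (*s) ((*v) N ^^ k)" for k
    by (induction k) (simp_all add: vec.linear_id[unfolded id_def] Vector_Spaces.linear_compose[unfolded o_def])
  have \<phi>: "\<phi> k *v v = ((*v) N ^^ k) v" for k v
    unfolding \<phi>_def by (simp add: matrix_works[OF lin])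
  define D where "D = DIM(complex^'n^'n)"
  have "\<exists>c :: nat \<Rightarrow> real. (\<exists>k\<le>D. c k \<noteq> 0) \<and> (\<Sum>k\<le>D. c k *\<^sub>R \<phi> k) = 0"
  proof (cases "inj_on \<phi> {..D}")
    case True
    then have "card (\<phi> ` {..D}) = Suc D" by (simp add: card_image)
    then have "dependent (\<phi> ` {..D})"
      by (intro dependent_biggerset) (auto simp: D_def)
    then obtain u where u: "\<exists>y\<in>\<phi> ` {..D}. u y \<noteq> 0" "(\<Sum>y\<in>\<phi> ` {..D}. u y *\<^sub>R y) = 0"
      by (subst (asm) real_vector.dependent_finite) auto
    then show ?thesis using True
      by (intro exI[of _ "\<lambda>k. u (\<phi> k)"]) (auto simp: sum.reindex)
  next
    case False
    then obtain i j where ij: "i \<le> D" "j \<le> D" "i \<noteq> j" "\<phi> i = \<phi> j"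
      by (auto simp: inj_on_def)
    \<comment> \<open>Two equal powers form a linearly dependent family but a single element of a set.\<close>
    define c where "c k = (if k = i then 1 else 0) - (if k = j then 1 else 0 :: real)" for k
    have "(\<Sum>k\<le>D. c k *\<^sub>R \<phi> k) = \<phi> i - \<phi> j"
      using ij unfolding c_def
      by (simp add: scaleR_diff_left sum_subtractf if_distrib[of "\<lambda>a. a *\<^sub>R _"] sum.delta cong: if_cong)
    then show ?thesis using ij by (intro exI[of _ c]) (auto simp: c_def)
  qed
  then obtain c :: "nat \<Rightarrow> real" and k0 where c: "k0 \<le> D" "c k0 \<noteq> 0" "(\<Sum>k\<le>D. c k *\<^sub>R \<phi> k) = 0"
    by blast
  define p where "p = (\<Sum>k\<le>D. monom (complex_of_real (c k)) k)"
  have cp: "coeff p k = (if k \<le> D then complex_of_real (c k) else 0)" for k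
    unfolding p_def by (simp add: coeff_sum sum.delta)
  have "p \<noteq> 0" using c cp[of k0] by auto
  moreover have "poly_apply p N v = 0" for v
  proof -
    have "degree p \<le> D" by (rule degree_le) (simp add: cp)
    then have "poly_apply p N v = (\<Sum>k\<le>D. complex_of_real (c k) *s (\<phi> k *v v))"
      by (simp add: poly_apply_upto cp \<phi>)
    also have "\<dots> = (\<Sum>k\<le>D. (c k *\<^sub>R \<phi> k) *v v)"
      by (intro sum.cong refl) (simp add: vec_eq_iff matrix_vector_mult_def scaleR_sum_right sum_distrib_left scaleR_conv_of_real[where 'a=complex] algebra_simps)
    also have "\<dots> = (\<Sum>k\<le>D. c k *\<^sub>R \<phi> k) *v v"
      by (induction D) (simp_all add: matrix_vector_mult_add_rdistrib)
    finally show ?thesis using c by simp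
  qed
  ultimately show ?thesis by blast
qed

definition power_bounded :: "real^'n^'n \<Rightarrow> real \<Rightarrow> real \<Rightarrow> bool" where
  "power_bounded M C \<rho> \<longleftrightarrow> 0 < C \<and> 0 < \<rho> \<and> \<rho> < 1 \<and>
     (\<forall>k v. norm (((*v) M ^^ k) v) \<le> C * \<rho> ^ k * norm v)"

lemma schur_imp_power_bounded:
  fixes M :: "real^'n^'n"
  assumes "schur M"
  shows "\<exists>C \<rho>. power_bounded M C \<rho>"
proof -
  let ?N = "complex_mat M"
  let ?c = "\<lambda>v :: real^'n. (\<chi> i. complex_of_real (v $ i))"
  have eig: "cmod z < 1" if "v \<noteq> 0" "?N *v v = z *s v" for z v
    using assms that unfolding schur_def eigenpair_def by blast
  obtain p where p: "p \<noteq> 0" "\<And>v. poly_apply p ?N v = 0"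
    using annihilating_poly_exists by blast
  have "\<exists>C \<rho>. 0 \<le> C \<and> 0 < \<rho> \<and> \<rho> < 1 \<and>
    (\<forall>v. poly_apply p ?N v = 0 \<longrightarrow> (\<forall>k. norm (((*v) ?N ^^ k) v) \<le> C * \<rho> ^ k * norm v))"
    by (rule power_decay_on_kernel[OF eig p(1)])
  then obtain C \<rho> where C: "0 \<le> C" "0 < \<rho>" "\<rho> < 1"
    "\<And>v k. norm (((*v) ?N ^^ k) v) \<le> C * \<rho> ^ k * norm v"
    unfolding p(2) by blast
  have nc: "norm (?c v) = norm v" for v
    by (simp add: norm_vec_def)
  have step: "?N *v ?c v = ?c (M *v v)" for v
    by (simp add: vec_eq_iff matrix_vector_mult_def complex_mat_def)
  have pow: "((*v) ?N ^^ k) (?c v) = ?c (((*v) M ^^ k) v)" for k v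
    by (induction k) (simp_all add: step)
  have "norm (((*v) M ^^ k) v) \<le> (C + 1) * \<rho> ^ k * norm v" for k v
  proof -
    have "norm (((*v) M ^^ k) v) \<le> C * \<rho> ^ k * norm v"
      using C(4)[of k "?c v"] by (simp add: pow nc)
    also have "\<dots> \<le> (C + 1) * \<rho> ^ k * norm v"
      using C by (intro mult_right_mono) auto
    finally show ?thesis .
  qed
  then show ?thesis using C unfolding power_bounded_def
    by (intro exI[of _ "C + 1"] exI[of _ \<rho>]) auto
qed

lemma inner_transpose:
  fixes M :: "real^'n^'m"
  shows "x \<bullet> (transpose M *v y) = (M *v x) \<bullet> y"
  by (metis dot_lmul_matrix inner_commute transpose_matrix_vector)

text \<open>\<open>(M\<^sup>T)\<^sup>k\<close> is the adjoint of \<open>M\<^sup>k\<close> and has the same operator norm.\<close>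
lemma power_bounded_transpose:
  assumes "power_bounded M C \<rho>"
  shows "power_bounded (transpose M) C \<rho>"
proof -
  have adj: "x \<bullet> (((*v) (transpose M) ^^ k) y) = (((*v) M ^^ k) x) \<bullet> y" for k x y
    proof (induction k arbitrary: x)
    case (Suc k)
    show ?case using Suc[of "M *v x"] by (simp add: inner_transpose) (simp only: funpow_swap1)
  qed simp
  have "norm (((*v) (transpose M) ^^ k) v) \<le> C * \<rho> ^ k * norm v" for k v
  proof (cases "((*v) (transpose M) ^^ k) v = 0")
    case True then show ?thesis using assms by (simp add: power_bounded_def)
  next
    case False
    let ?y = "((*v) (transpose M) ^^ k) v"
    have "norm ?y * norm ?y = (((*v) M ^^ k) ?y) \<bullet> v"
      by (simp flip: adj power2_norm_eq_inner add: power2_eq_square)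
    also have "\<dots> \<le> (C * \<rho> ^ k * norm ?y) * norm v"
      using assms by (intro order_trans[OF norm_cauchy_schwarz] mult_right_mono) (auto simp: power_bounded_def)
    finally have "norm ?y * norm ?y \<le> (C * \<rho> ^ k * norm v) * norm ?y" by (simp add: algebra_simps)
    then show ?thesis using False by (simp add: mult_le_cancel_right)
  qed
  then show ?thesis using assms by (simp add: power_bounded_def)
qed

section \<open>Quadratic forms of symmetric matrices\<close>

abbreviation quad :: "real^'n^'n \<Rightarrow> real^'n \<Rightarrow> real" where
  "quad M x \<equiv> x \<bullet> (M *v x)"

lemma sym_inner:
  fixes M :: "real^'n^'n"
  assumes "transpose M = M"
  shows "x \<bullet> (M *v y) = y \<bullet> (M *v x)"
  by (metis assms inner_transpose inner_commute)

lemma matrix_vector_neg: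
  fixes M :: "real^'n^'m"
  shows "M *v (- x) = - (M *v x)"
  by (rule linear_neg) simp

lemma quad_add:
  fixes M :: "real^'n^'n"
  assumes "transpose M = M"
  shows "quad M (x + y) = quad M x + 2 * (x \<bullet> (M *v y)) + quad M y"
  using sym_inner[OF assms, of x y] by (simp add: algebra_simps inner_add_left inner_add_right)

lemma quad_scaleR:
  fixes M :: "real^'n^'n"
  shows "quad M (c *\<^sub>R x) = c\<^sup>2 * quad M x"
  by (simp add: matrix_vector_mult_scaleR power2_eq_square)

text \<open>Let \<open>x\<close> be a zero of the form and \<open>y = M x\<close>. The form at \<open>x - s y\<close>
  equals \<open>s\<^sup>2 y\<^sup>T M y - 2 s \<parallel>y\<parallel>\<^sup>2\<close>, which is negative for small \<open>s > 0\<close> unless \<open>y = 0\<close>.\<close>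
lemma psd_quad_zero:
  assumes "psd M" "quad M x = 0"
  shows "M *v x = 0"
proof -
  have sym: "transpose M = M" and nonneg: "\<And>x. 0 \<le> quad M x" using assms by (auto simp: psd_def)
  let ?y = "M *v x"
  define c d where "c = ?y \<bullet> ?y" and "d = quad M ?y"
  \<comment> \<open>Adding \<open>1\<close> to \<open>d\<close> keeps the step small enough and also covers \<open>d = 0\<close>.\<close>
  define s where "s = c / (d + 1)"
  have d: "0 \<le> d" using nonneg by (simp add: d_def)
  have "0 \<le> quad M (x + (- s) *\<^sub>R ?y)" by (rule nonneg)
  also have "\<dots> = - 2 * s * c + s\<^sup>2 * d"
    unfolding quad_add[OF sym] quad_scaleR
    using sym_inner[OF sym, of x ?y] assms(2)
    by (simp add: matrix_vector_mult_scaleR matrix_vector_neg c_def d_def)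
  finally have "2 * s * c \<le> s\<^sup>2 * d" by simp
  then have "2 * (s * c * (d + 1)\<^sup>2) \<le> s\<^sup>2 * d * (d + 1)\<^sup>2"
    using mult_right_mono[of "2 * s * c" "s\<^sup>2 * d" "(d + 1)\<^sup>2"] by (simp add: mult.assoc)
  moreover have "s * (d + 1) = c" using d by (simp add: s_def)
  then have "s * c * (d + 1)\<^sup>2 = c\<^sup>2 * (d + 1)" "s\<^sup>2 * d * (d + 1)\<^sup>2 = c\<^sup>2 * d"
    by (auto simp: power2_eq_square)
  ultimately have "2 * (c\<^sup>2 * (d + 1)) \<le> c\<^sup>2 * d" by simp
  then have "c\<^sup>2 * (d + 2) \<le> 0" by (simp add: algebra_simps)
  then have "c\<^sup>2 = 0" using d by (smt (verit) mult_pos_pos zero_le_power2)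
  then show ?thesis by (simp add: c_def)
qed

lemma sym_matrix_eqI:
  fixes M N :: "real^'n^'n"
  assumes "transpose M = M" "transpose N = N" "\<And>x. quad M x = quad N x"
  shows "M = N"
proof -
  have "x \<bullet> (M *v y) = x \<bullet> (N *v y)" for x y
    using quad_add[OF assms(1), of x y] quad_add[OF assms(2), of x y] assms(3) by simp
  then have "(M *v y - N *v y) \<bullet> (M *v y - N *v y) = 0" for y by (simp only: inner_diff_right)
  then show ?thesis by (simp add: matrix_eq)
qed

lemma tendsto_matrix_vector:
  fixes Y :: "nat \<Rightarrow> real^'n^'m"
  assumes "Y \<longlonglongrightarrow> X" "v \<longlonglongrightarrow> w"
  shows "(\<lambda>k. Y k *v v k) \<longlonglongrightarrow> X *v w"
  unfolding matrix_vector_mult_def by (intro vec_tendstoI) (auto intro!: tendsto_intros assms)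

text \<open>Polarization: the entries of a symmetric matrix are combinations of three values of its
  quadratic form. With this, monotone limits of matrices reduce to monotone limits of
  reals.\<close>
lemma sym_matrix_convergent:
  fixes Y :: "nat \<Rightarrow> real^'n^'n"
  assumes sym: "\<And>k. transpose (Y k) = Y k" and conv: "\<And>x. convergent (\<lambda>k. quad (Y k) x)"
  shows "\<exists>X. Y \<longlonglongrightarrow> X \<and> transpose X = X \<and> (\<forall>x. (\<lambda>k. quad (Y k) x) \<longlonglongrightarrow> quad X x)"
proof -
  have "convergent (\<lambda>k. Y k $ i $ j)" for i j
  proof -
    let ?e = "\<lambda>i. axis i (1::real) :: real^'n"
    have "Y k $ i $ j = (quad (Y k) (?e i + ?e j) - quad (Y k) (?e i) - quad (Y k) (?e j)) / 2" for k
    proof -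
      have "?e i \<bullet> (Y k *v ?e j) = Y k $ i $ j"
        by (simp add: inner_axis' matrix_vector_mult_basis column_def)
      then show ?thesis using quad_add[OF sym[of k], of "?e i" "?e j"] by simp
    qed
    then have eq: "(\<lambda>k. Y k $ i $ j) = (\<lambda>k. (quad (Y k) (?e i + ?e j) - quad (Y k) (?e i) - quad (Y k) (?e j)) * (1/2))"
      by auto
    show ?thesis unfolding eq by (intro convergent_mult convergent_diff conv convergent_const)
  qed
  then obtain L where L: "\<And>i j. (\<lambda>k. Y k $ i $ j) \<longlonglongrightarrow> L i j" unfolding convergent_def by metis
  define X where "X = (\<chi> i j. L i j)"
  have lim: "Y \<longlonglongrightarrow> X" unfolding X_def by (intro vec_tendstoI) (simp add: L)
  have "L i j = L j i" for i j
  proof -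
    have "Y k $ i $ j = Y k $ j $ i" for k by (metis sym transpose_def vec_lambda_beta)
    then show ?thesis using L[of i j] L[of j i] by (auto intro: LIMSEQ_unique)
  qed
  then have "transpose X = X" by (simp add: X_def transpose_def vec_eq_iff)
  moreover have "(\<lambda>k. quad (Y k) x) \<longlonglongrightarrow> quad X x" for x
    by (intro tendsto_intros tendsto_matrix_vector lim)
  ultimately show ?thesis using lim by blast
qed

lemma transpose_add: "transpose (M + N) = transpose M + transpose (N :: real^'n^'m)"
  by (simp add: transpose_def vec_eq_iff)

lemma transpose_diff: "transpose (M - N) = transpose M - transpose (N :: real^'n^'m)"
  by (simp add: transpose_def vec_eq_iff)

lemma psd_add: "psd M \<Longrightarrow> psd N \<Longrightarrow> psd (M + N)"
  by (auto simp: psd_def transpose_add matrix_vector_mult_add_rdistrib inner_add_right)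

lemma quad_congruence:
  fixes M :: "real^'n^'n" and B :: "real^'m^'n"
  shows "quad (transpose B ** M ** B) x = quad M (B *v x)"
  by (simp add: inner_transpose flip: matrix_vector_mul_assoc)

lemma psd_congruence:
  fixes M :: "real^'n^'n" and B :: "real^'m^'n"
  assumes "psd M" shows "psd (transpose B ** M ** B)"
  using assms unfolding psd_def quad_congruence
  by (simp add: matrix_transpose_mul matrix_mul_assoc)

text \<open>\<open>P\<close> is the increasing limit of the partial sums of \<open>\<Sum>\<^sub>k (M\<^sup>T)\<^sup>k W M\<^sup>k\<close>: the total
  cost with weight \<open>W\<close> of the free motion under \<open>M\<close>.\<close>
lemma psd_lyapunov:
  fixes M W :: "real^'n^'n"
  assumes "schur M" "psd W"
  shows "\<exists>P. psd P \<and> (\<forall>x. quad P x = quad P (M *v x) + quad W x)"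
proof -
  obtain C \<rho> where pb: "power_bounded M C \<rho>" using schur_imp_power_bounded assms by blast
  define Y where "Y = rec_nat 0 (\<lambda>_ P. transpose M ** P ** M + W)"
  have Y0: "Y 0 = 0" and YS: "\<And>k. Y (Suc k) = transpose M ** Y k ** M + W" by (simp_all add: Y_def)
  have psd: "psd (Y k)" for k
    by (induction k) (auto simp: Y0 YS intro!: psd_add psd_congruence assms, auto simp: psd_def transpose_def vec_eq_iff)
  have step: "quad (Y (Suc k)) x = quad (Y k) (M *v x) + quad W x" for k x
    by (simp add: YS matrix_vector_mult_add_rdistrib inner_add_right quad_congruence)
  have form: "quad (Y n) x = (\<Sum>k<n. quad W (((*v) M ^^ k) x))" for n x
  proof (induction n arbitrary: x)
    case (Suc n)
    then show ?case by (simp add: step sum.lessThan_Suc_shift funpow_swap1 del: sum.lessThan_Suc)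
  qed (simp add: Y0)
  obtain L where L: "\<And>v. norm (W *v v) \<le> norm v * L" "0 \<le> L"
    using bounded_linear.nonneg_bounded[OF matrix_vector_mul_bounded_linear[of W]] by blast
  have "convergent (\<lambda>n. quad (Y n) x)" for x
  proof -
    have bd: "norm (quad W (((*v) M ^^ k) x)) \<le> (C * norm x)\<^sup>2 * L * (\<rho>\<^sup>2) ^ k" for k
    proof -
      let ?v = "((*v) M ^^ k) x"
      have "norm (quad W ?v) \<le> norm ?v * (norm ?v * L)"
        unfolding real_norm_def
        by (rule order_trans[OF Cauchy_Schwarz_ineq2]) (auto intro!: mult_left_mono L)
      also have "\<dots> = (norm ?v)\<^sup>2 * L" by (simp add: power2_eq_square)
      also have "\<dots> \<le> (C * \<rho> ^ k * norm x)\<^sup>2 * L"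
        using pb L(2) by (intro mult_right_mono power_mono) (auto simp: power_bounded_def)
      finally show ?thesis by (simp add: power_mult_distrib power_even_eq[symmetric] mult_ac flip: power_mult)
    qed
    have "\<rho>\<^sup>2 < 1" using pb by (auto simp: power_bounded_def power_less_one_iff abs_square_less_1)
    then have "summable (\<lambda>k. quad W (((*v) M ^^ k) x))"
      by (intro summable_comparison_test'[OF _ bd] summable_mult summable_geometric) auto
    then show ?thesis unfolding form by (simp add: summable_iff_convergent)
  qed
  then obtain P where P: "transpose P = P" "\<And>x. (\<lambda>k. quad (Y k) x) \<longlonglongrightarrow> quad P x"
    using sym_matrix_convergent[of Y] psd by (auto simp: psd_def)
  have "0 \<le> quad P x" for x
    by (rule LIMSEQ_le_const[OF P(2)]) (use psd in \<open>auto simp: psd_def\<close>)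
  moreover have "quad P x = quad P (M *v x) + quad W x" for x
  proof (rule LIMSEQ_unique)
    show "(\<lambda>k. quad (Y (Suc k)) x) \<longlonglongrightarrow> quad P x" using P(2) by (rule LIMSEQ_Suc)
    show "(\<lambda>k. quad (Y (Suc k)) x) \<longlonglongrightarrow> quad P (M *v x) + quad W x"
      unfolding step by (rule tendsto_add[OF P(2) tendsto_const])
  qed
  ultimately show ?thesis using P(1) unfolding psd_def by blast
qed

section \<open>The Riccati map\<close>

definition input_weight :: "real^'u^'x \<Rightarrow> real^'u^'u \<Rightarrow> real^'x^'x \<Rightarrow> real^'u^'u" where
  "input_weight Bu R X = R + transpose Bu ** X ** Bu"

definition riccati ::
  "real^'x^'x \<Rightarrow> real^'u^'x \<Rightarrow> real^'x^'x \<Rightarrow> real^'u^'u \<Rightarrow> real^'x^'x \<Rightarrow> real^'x^'x" where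
  "riccati A Bu Q R X = transpose A ** X ** A + Q
     - transpose A ** X ** Bu ** matrix_inv (input_weight Bu R X) ** transpose Bu ** X ** A"

lemma pd_imp_psd: "pd M \<Longrightarrow> psd M"
  by (metis inner_zero_left less_imp_le order_refl pd_def psd_def)

lemma pd_input_weight: 
  assumes "pd R" "psd X" shows "pd (input_weight Bu R X)"
proof -
  have "psd (transpose Bu ** X ** Bu)" by (rule psd_congruence[OF assms(2)])
  with assms(1) show ?thesis
    by (auto simp: pd_def psd_def input_weight_def transpose_add matrix_vector_mult_add_rdistrib inner_add_right
        intro: add_pos_nonneg)
qed

lemma pd_invertible:
  assumes "pd M" shows "invertible M"
proof -
  have "\<And>x. M *v x = 0 \<Longrightarrow> x = 0" using assms by (force simp: pd_def)
  then show ?thesis by (simp add: invertible_left_inverse matrix_left_invertible_ker)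
qed

lemma pd_inv_right:
  assumes "pd M" shows "M *v (matrix_inv M *v x) = x"
proof -
  have "M ** matrix_inv M = mat 1 \<and> matrix_inv M ** M = mat 1"
    using pd_invertible[OF assms] unfolding matrix_inv_def invertible_def by (rule someI_ex)
  then show ?thesis by (simp add: matrix_vector_mul_assoc)
qed

lemma pd_inv_sym:
  assumes "pd M"
  shows "transpose (matrix_inv M) = matrix_inv M"
proof -
  have sym: "transpose M = M" using assms by (simp add: pd_def)
  have "x \<bullet> (transpose (matrix_inv M) *v y) = x \<bullet> (matrix_inv M *v y)" for x y
  proof -
    let ?a = "matrix_inv M *v x" and ?b = "matrix_inv M *v y"
    have "?a \<bullet> (M *v ?b) = ?b \<bullet> (M *v ?a)" by (rule sym_inner[OF sym])
    then show ?thesis by (simp add: pd_inv_right[OF assms] inner_transpose inner_commute)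
  qed
  then have "(transpose (matrix_inv M) *v y - matrix_inv M *v y)
      \<bullet> (transpose (matrix_inv M) *v y - matrix_inv M *v y) = 0" for y
    by (simp only: inner_diff_right)
  then show ?thesis by (simp add: matrix_eq)
qed

lemma gain_x_normal_eq:
  assumes "pd R" "psd X"
  shows "input_weight Bu R X *v (gain_x A Bu R X *v x) = transpose Bu *v (X *v (A *v x))"
  unfolding gain_x_def input_weight_def[symmetric] matrix_vector_mul_assoc[symmetric]
  by (rule pd_inv_right[OF pd_input_weight[OF assms]])

lemma gain_v_normal_eq:
  assumes "pd R" "psd X"
  shows "input_weight Bu R X *v (gain_v Bu R X *v g) = transpose Bu *v g"
  unfolding gain_v_def input_weight_def[symmetric] matrix_vector_mul_assoc[symmetric]
  by (rule pd_inv_right[OF pd_input_weight[OF assms]])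

lemma riccati_sym:
  assumes "transpose Q = Q" "pd R" "psd X"
  shows "transpose (riccati A Bu Q R X) = riccati A Bu Q R X"
  using assms pd_inv_sym[OF pd_input_weight[OF assms(2,3), of Bu]]
  by (simp add: riccati_def transpose_add transpose_diff matrix_transpose_mul matrix_mul_assoc psd_def)

lemma quad_riccati:
  assumes "pd R" "psd X"
  shows "quad (riccati A Bu Q R X) x =
     quad X (A *v x) + quad Q x - quad (input_weight Bu R X) (gain_x A Bu R X *v x)"
proof -
  let ?K = "gain_x A Bu R X"
  have "quad (input_weight Bu R X) (?K *v x) = (A *v x) \<bullet> (X *v (Bu *v (?K *v x)))"
    unfolding gain_x_normal_eq[OF assms] inner_transpose
    using assms(2) by (auto simp: psd_def intro: sym_inner)
  moreover have "riccati A Bu Q R X *v x = transpose A *v (X *v (A *v x)) + Q *v x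
     - transpose A *v (X *v (Bu *v (?K *v x)))"
    by (simp add: riccati_def gain_x_def input_weight_def matrix_vector_mul_assoc matrix_mul_assoc
        matrix_vector_mult_add_rdistrib matrix_vector_mult_diff_rdistrib)
  ultimately show ?thesis by (simp add: inner_add_right inner_diff_right inner_transpose)
qed

text \<open>The left-hand side is the stage cost plus the cost-to-go \<open>y\<^sup>T X y + 2 y\<^sup>T s\<close> at the next
  state \<open>y = A x + w + Bu u\<close>. As a function of \<open>u\<close> it is minimal at \<open>- Kx x - Kv g\<close>; the
  terms linear in \<open>x\<close> collect into the closed-loop matrix, so that a cost-to-go of the same form
  results one step earlier, with \<open>riccati A Bu Q R X\<close> in the place of \<open>X\<close>.\<close>
lemma complete_square:
  fixes A :: "real^'x^'x" and Bu :: "real^'u^'x" and w s :: "real^'x"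
  assumes "pd R" "psd X"
  defines "g \<equiv> X *v w + s"
  shows "quad Q x + quad R u + quad X (A *v x + w + Bu *v u) + 2 * ((A *v x + w + Bu *v u) \<bullet> s)
     = quad (input_weight Bu R X) (u + gain_x A Bu R X *v x + gain_v Bu R X *v g)
       + quad (riccati A Bu Q R X) x
       + 2 * (x \<bullet> (transpose (A - Bu ** gain_x A Bu R X) *v g))
       + (quad X w + 2 * (w \<bullet> s) - quad (input_weight Bu R X) (gain_v Bu R X *v g))"
proof -
  let ?H = "input_weight Bu R X" and ?k = "gain_x A Bu R X *v x" and ?m = "gain_v Bu R X *v g"
  have symX: "transpose X = X" using assms(2) by (simp add: psd_def)
  have symH: "transpose ?H = ?H" using pd_input_weight[OF assms(1,2)] by (simp add: pd_def)
  have H: "quad ?H u = quad R u + quad X (Bu *v u)"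
    by (simp add: input_weight_def matrix_vector_mult_add_rdistrib inner_add_right quad_congruence)
  have k: "y \<bullet> (?H *v ?k) = (Bu *v y) \<bullet> (X *v (A *v x))" for y
    unfolding gain_x_normal_eq[OF assms(1,2)] inner_transpose ..
  have m: "y \<bullet> (?H *v ?m) = (Bu *v y) \<bullet> g" for y
    unfolding gain_v_normal_eq[OF assms(1,2)] inner_transpose ..
  have "quad ?H (u + ?k + ?m) = quad ?H u + quad ?H ?k + quad ?H ?m
      + 2 * ((Bu *v u) \<bullet> (X *v (A *v x))) + 2 * ((Bu *v u) \<bullet> g) + 2 * ((Bu *v ?k) \<bullet> g)"
    unfolding quad_add[OF symH] by (simp add: inner_add_left matrix_vector_right_distrib k m)
  moreover have "x \<bullet> (transpose (A - Bu ** gain_x A Bu R X) *v g) = (A *v x) \<bullet> g - (Bu *v ?k) \<bullet> g"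
    by (simp add: inner_transpose matrix_vector_mult_diff_rdistrib inner_diff_left flip: matrix_vector_mul_assoc)
  moreover have "quad X (A *v x + w + Bu *v u) = quad X (A *v x) + quad X w + quad X (Bu *v u)
      + 2 * ((A *v x) \<bullet> (X *v w)) + 2 * ((Bu *v u) \<bullet> (X *v w)) + 2 * ((Bu *v u) \<bullet> (X *v (A *v x)))"
    unfolding quad_add[OF symX] using sym_inner[OF symX] by (simp add: inner_add_left inner_add_right matrix_vector_right_distrib)
  ultimately show ?thesis
    unfolding quad_riccati[OF assms(1,2)] H g_def by (simp add: inner_add_left inner_add_right)
qed

lemma riccati_completion:
  assumes "pd R" "psd X"
  shows "quad Q x + quad R u + quad X (A *v x + Bu *v u)
     = quad (input_weight Bu R X) (u + gain_x A Bu R X *v x) + quad (riccati A Bu Q R X) x"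
  using complete_square[OF assms, where w = 0 and s = 0, where Q = Q and x = x and u = u and A = A and Bu = Bu] by simp

lemma riccati_le:
  assumes "pd R" "psd X"
  shows "quad (riccati A Bu Q R X) x \<le> quad Q x + quad R u + quad X (A *v x + Bu *v u)"
  using riccati_completion[OF assms, where Q = Q and x = x and u = u and A = A and Bu = Bu] pd_imp_psd[OF pd_input_weight[OF assms, of Bu]]
  by (simp add: psd_def)

lemma riccati_closed_loop:
  assumes "pd R" "psd X"
  shows "quad (riccati A Bu Q R X) x = quad Q x + quad R (gain_x A Bu R X *v x)
     + quad X ((A - Bu ** gain_x A Bu R X) *v x)"
proof -
  let ?k = "gain_x A Bu R X *v x"
  have e: "(A - Bu ** gain_x A Bu R X) *v x = A *v x + Bu *v (- ?k)"
    by (simp add: matrix_vector_mult_diff_rdistrib matrix_vector_mul_assoc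
        matrix_vector_neg)
  show ?thesis unfolding e
    using riccati_completion[OF assms, where Q = Q and x = x and u = "- ?k" and A = A and Bu = Bu] 
    by (simp add: matrix_vector_neg)
qed

lemma psd_riccati:
  assumes "psd Q" "pd R" "psd X"
  shows "psd (riccati A Bu Q R X)"
  using assms riccati_sym[of Q R X A Bu] pd_imp_psd[OF assms(2)]
  by (auto simp: psd_def riccati_closed_loop[OF assms(2,3)])

text \<open>The Riccati map is a minimum over \<open>u\<close> of expressions that are monotone in \<open>Q\<close> and
  \<open>X\<close>; it suffices to insert the minimizer for the larger data.\<close>
lemma riccati_mono:
  assumes "pd R" "psd X" "psd Y" "\<And>x. quad Q x \<le> quad Q' x" "\<And>x. quad X x \<le> quad Y x"
  shows "quad (riccati A Bu Q R X) x \<le> quad (riccati A Bu Q' R Y) x"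
proof -
  let ?k = "gain_x A Bu R Y *v x"
  have "quad (riccati A Bu Q R X) x \<le> quad Q x + quad R (- ?k) + quad X (A *v x + Bu *v (- ?k))"
    by (rule riccati_le[OF assms(1,2)])
  also have "\<dots> \<le> quad Q' x + quad R (- ?k) + quad Y (A *v x + Bu *v (- ?k))"
    by (intro add_mono assms order_refl)
  also have "\<dots> = quad (riccati A Bu Q' R Y) x"
    unfolding riccati_completion[OF assms(1,3)] by simp
  finally show ?thesis .
qed

section \<open>Eigenvalues of limits of Schur matrices\<close>

text \<open>The zeros of \<open>det (I - z M)\<close> are the reciprocals of the nonzero eigenvalues of \<open>M\<close>.
  Hence \<open>M\<close> being Schur implies that there is no zero in the unit disk, a condition on a
  connected open set as needed for Hurwitz' theorem.\<close>
definition reverse_charpoly :: "real^'n^'n \<Rightarrow> complex \<Rightarrow> complex" where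
  "reverse_charpoly M z = det (\<chi> i j. (if i = j then 1 else 0) - z * complex_of_real (M $ i $ j))"

lemma reverse_charpoly_matrix:
  fixes M :: "real^'n^'n"
  shows "(\<chi> i j. (if i = j then 1 else 0) - z * complex_of_real (M $ i $ j)) *v v
     = v - z *s (complex_mat M *v v)"
  by (simp add: vec_eq_iff matrix_vector_mult_def complex_mat_def left_diff_distrib sum_subtractf
      sum_distrib_left mult.assoc if_distrib[of "\<lambda>a. a * _"] cong: if_cong)

lemma reverse_charpoly_zero_iff:
  fixes M :: "real^'n^'n"
  shows "reverse_charpoly M z = 0 \<longleftrightarrow> (\<exists>v. v \<noteq> 0 \<and> v = z *s (complex_mat M *v v))"
  unfolding reverse_charpoly_def
  using invertible_det_nz[of "\<chi> i j. (if i = j then 1 else 0) - z * complex_of_real (M $ i $ j)"]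
  by (auto simp: invertible_left_inverse matrix_left_invertible_ker reverse_charpoly_matrix)

text \<open>By Hurwitz' theorem, zero-freeness in the open unit disk of \<open>det (I - z Y\<^sub>k)\<close> carries over
  to the locally uniform limit, which takes the value \<open>1\<close> at \<open>0\<close> and so is not identically
  zero.\<close>
lemma schur_limit_eigenvalue:
  fixes M :: "real^'n^'n"
  assumes schur: "\<And>k. schur (Y k)" and lim: "Y \<longlonglongrightarrow> M" and ev: "eigenpair M z v"
  shows "cmod z \<le> 1"
proof (rule ccontr)
  assume "\<not> cmod z \<le> 1"
  then have z: "cmod z > 1" by simp
  then have "z \<noteq> 0" by auto
  let ?f = "reverse_charpoly"
  have hol: "?f N holomorphic_on S" for N :: "real^'n^'n" and S
    unfolding reverse_charpoly_def det_def
    by (simp only: vec_lambda_beta) (intro holomorphic_intros)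
  have cont: "continuous_on S (\<lambda>(N :: real^'n^'n, z). ?f N z)" for S
    unfolding reverse_charpoly_def det_def split_beta
    by (simp only: vec_lambda_beta) (intro continuous_intros)
  have nz: "?f (Y k) w \<noteq> 0" if "w \<in> ball 0 1" for k w
  proof
    assume "?f (Y k) w = 0"
    then obtain v where v: "v \<noteq> 0" "v = w *s (complex_mat (Y k) *v v)"
      by (auto simp: reverse_charpoly_zero_iff)
    then have "w \<noteq> 0" by auto
    then have "complex_mat (Y k) *v v = (1 / w) *s v"
      by (subst (2) v(2)) (simp add: vector_smult_assoc)
    then have "cmod (1 / w) < 1" using v schur[of k] by (auto simp: schur_def eigenpair_def)
    moreover have "cmod w < 1" using that by simp
    ultimately show False using \<open>w \<noteq> 0\<close> by (simp add: norm_divide divide_simps split: if_splits)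
  qed
  have unif: "uniform_limit K (\<lambda>k. ?f (Y k)) (?f M) sequentially" if K: "compact K" for K
    unfolding uniform_limit_iff
  proof (intro allI impI)
    fix e :: real assume "0 < e"
    have "uniformly_continuous_on (cball M 1 \<times> K) (\<lambda>(N, z). ?f N z)"
      by (intro compact_uniformly_continuous cont compact_Times K compact_cball)
    then obtain d where d: "d > 0" "\<And>p q. p \<in> cball M 1 \<times> K \<Longrightarrow> q \<in> cball M 1 \<times> K \<Longrightarrow> dist q p < d \<Longrightarrow>
        dist ((\<lambda>(N, z). ?f N z) q) ((\<lambda>(N, z). ?f N z) p) < e"
      using \<open>0 < e\<close> unfolding uniformly_continuous_on_def by metis
    have "\<forall>\<^sub>F k in sequentially. dist (Y k) M < min d 1"
      using lim d(1) by (intro tendstoD) auto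
    then show "\<forall>\<^sub>F k in sequentially. \<forall>w\<in>K. dist (?f (Y k) w) (?f M w) < e"
    proof eventually_elim
      case (elim k)
      then show ?case using d(2)[of "(M, _)" "(Y k, _)"]
        by (auto simp: dist_Pair_Pair dist_commute)
    qed
  qed
  have zero: "?f M (1 / z) = 0"
    unfolding reverse_charpoly_zero_iff using ev \<open>z \<noteq> 0\<close>
    by (intro exI[of _ v]) (auto simp: eigenpair_def vector_smult_assoc)
  have inb: "1 / z \<in> ball 0 1" using z by (simp add: norm_divide divide_simps)
  have "?f M 0 = 1"
  proof -
    have "(\<chi> i j. (if i = j then 1 else 0) - 0 * complex_of_real (M $ i $ j)) = mat 1"
      by (simp add: mat_def)
    then show ?thesis by (simp only: reverse_charpoly_def det_I)
  qed
  with zero inb have nonconst: "\<not> ?f M constant_on ball 0 1"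
    unfolding constant_on_def by (metis centre_in_ball zero_less_one zero_neq_one)
  have "?f M (1 / z) \<noteq> 0"
    by (rule Hurwitz_no_zeros[of "ball 0 1" "\<lambda>k. ?f (Y k)"])
      (use hol unif nonconst nz inb in auto)
  with zero show False by simp
qed

text \<open>With \<open>v = a + i b\<close>, the sum \<open>a\<^sup>T S a + b\<^sup>T S b\<close> is the Hermitian form of \<open>S\<close> at \<open>v\<close>. This
  keeps all later eigenvalue arguments within real matrices.\<close>
lemma eigenpair_quad:
  fixes M S :: "real^'n^'n"
  assumes ev: "eigenpair M z v" and sym: "transpose S = S"
  defines "a \<equiv> \<chi> i. Re (v $ i)" and "b \<equiv> \<chi> i. Im (v $ i)"
  shows "quad S (M *v a) + quad S (M *v b) = (cmod z)\<^sup>2 * (quad S a + quad S b)"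
proof -
  have "(complex_mat M *v v) $ i = z * v $ i" for i
    using ev by (simp add: eigenpair_def)
  then have c: "(\<Sum>j\<in>UNIV. complex_of_real (M $ i $ j) * v $ j) = z * v $ i" for i
    by (simp add: matrix_vector_mult_def complex_mat_def)
  have Ma: "M *v a = Re z *\<^sub>R a + (- Im z) *\<^sub>R b" and Mb: "M *v b = Re z *\<^sub>R b + Im z *\<^sub>R a"
    using c[THEN arg_cong[where f = Re]] c[THEN arg_cong[where f = Im]]
    by (simp_all add: vec_eq_iff matrix_vector_mult_def a_def b_def)
  show ?thesis
    unfolding Ma Mb quad_add[OF sym] quad_scaleR matrix_vector_mult_scaleR cmod_power2
    using sym_inner[OF sym, of a b] by (simp add: power2_eq_square algebra_simps)
qed

lemma eigenpair_parts_pos: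
  assumes "eigenpair M z v"
  shows "0 < (\<chi> i. Re (v $ i)) \<bullet> (\<chi> i. Re (v $ i)) + (\<chi> i. Im (v $ i)) \<bullet> (\<chi> i. Im (v $ i))"
proof -
  have "(\<chi> i. Re (v $ i)) \<noteq> 0 \<or> (\<chi> i. Im (v $ i)) \<noteq> 0"
    using assms by (auto simp: eigenpair_def vec_eq_iff complex_eq_iff)
  then show ?thesis by (auto simp: add_pos_nonneg add_nonneg_pos)
qed

text \<open>At an eigenvector for \<open>z\<close> the Hermitian form of \<open>S\<close> is multiplied by \<open>\<bar>z\<bar>\<^sup>2\<close> in one step,
  while it decreases strictly.\<close>
lemma schur_if_lyapunov_decrease:
  fixes M S :: "real^'n^'n"
  assumes "psd S" "0 < \<epsilon>" and dec: "\<And>x. quad S (M *v x) + \<epsilon> * (x \<bullet> x) \<le> quad S x"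
  shows "schur M"
  unfolding schur_def
proof (intro allI impI, elim exE)
  fix z v assume ev: "eigenpair M z v"
  let ?a = "\<chi> i. Re (v $ i)" and ?b = "\<chi> i. Im (v $ i)"
  let ?q = "quad S ?a + quad S ?b"
  have "0 \<le> ?q" using assms(1) by (simp add: psd_def)
  have "0 < \<epsilon> * (?a \<bullet> ?a + ?b \<bullet> ?b)" using eigenpair_parts_pos[OF ev] assms(2) by simp
  moreover have "(cmod z)\<^sup>2 * ?q + \<epsilon> * (?a \<bullet> ?a + ?b \<bullet> ?b) \<le> ?q"
    using dec[of ?a] dec[of ?b] eigenpair_quad[OF ev, of S] assms(1) by (simp add: psd_def algebra_simps)
  ultimately have "(cmod z)\<^sup>2 * ?q < 1 * ?q"
    by (simp only: mult_1)
  then have "(cmod z)\<^sup>2 < 1" using \<open>0 \<le> ?q\<close> by (simp only: mult_less_cancel_right)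
  then show "cmod z < 1" by (simp add: abs_square_less_1)
qed

section \<open>The stabilizing solution of the Riccati equation\<close>

lemma pd_coercive:
  fixes R :: "real^'n^'n"
  assumes "pd R"
  shows "\<exists>r>0. \<forall>y. r * (norm y)\<^sup>2 \<le> quad R y"
proof -
  have "\<exists>y\<in>sphere 0 1. \<forall>x\<in>sphere 0 1. quad R y \<le> quad R x"
    by (intro continuous_attains_inf compact_sphere continuous_intros
        linear_continuous_on) auto
  then obtain y where y: "norm y = 1" "\<And>x. norm x = 1 \<Longrightarrow> quad R y \<le> quad R x" by auto
  have "y \<noteq> 0" using y(1) by auto
  then have "0 < quad R y" using assms by (simp add: pd_def)
  moreover have "quad R y * (norm x)\<^sup>2 \<le> quad R x" for x
  proof (cases "x = 0")
    case False
    have "quad R y \<le> quad R ((1 / norm x) *\<^sub>R x)" using False by (intro y(2)) simp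
    then show ?thesis unfolding quad_scaleR using False by (simp add: divide_simps power2_eq_square)
  qed simp
  ultimately show ?thesis by blast
qed

lemma tendsto_matrixI:
  fixes Y :: "nat \<Rightarrow> real^'n^'m"
  assumes "\<And>v. (\<lambda>k. Y k *v v) \<longlonglongrightarrow> X *v v"
  shows "Y \<longlonglongrightarrow> X"
proof (intro vec_tendstoI)
  fix i j
  have "(\<lambda>k. (Y k *v axis j 1) $ i) \<longlonglongrightarrow> (X *v axis j 1) $ i" by (intro tendsto_intros assms)
  then show "(\<lambda>k. Y k $ i $ j) \<longlonglongrightarrow> X $ i $ j" by (simp add: matrix_vector_mult_basis column_def)
qed

text \<open>The gain solves \<open>(R + Bu\<^sup>T Y\<^sub>k Bu) K = Bu\<^sup>T Y\<^sub>k A\<close>. All these systems are uniformly coercive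
  with the constant of \<open>R\<close>, so a residual that tends to zero forces the solutions to
  converge.\<close>
lemma tendsto_gain_x:
  fixes A :: "real^'x^'x" and Bu :: "real^'u^'x"
  assumes "pd R" and psd: "\<And>k. psd (Y k)" "psd X" and lim: "Y \<longlonglongrightarrow> X"
  shows "(\<lambda>k. gain_x A Bu R (Y k)) \<longlonglongrightarrow> gain_x A Bu R X"
proof (rule tendsto_matrixI)
  fix v
  obtain r where r: "r > 0" "\<And>y. r * (norm y)\<^sup>2 \<le> quad R y" using pd_coercive[OF assms(1)] by blast
  have low: "r * norm y \<le> norm (input_weight Bu R (Y k) *v y)" for k y
  proof (cases "y = 0")
    case False
    have "r * (norm y)\<^sup>2 \<le> quad R y + quad (Y k) (Bu *v y)"
      using r(2)[of y] psd(1)[of k] by (simp add: psd_def add_increasing2)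
    also have "\<dots> = quad (input_weight Bu R (Y k)) y"
      by (simp add: input_weight_def matrix_vector_mult_add_rdistrib inner_add_right quad_congruence)
    also have "\<dots> \<le> norm y * norm (input_weight Bu R (Y k) *v y)" by (rule norm_cauchy_schwarz)
    finally have "norm y * (r * norm y) \<le> norm y * norm (input_weight Bu R (Y k) *v y)"
      by (simp add: power2_eq_square mult_ac)
    then show ?thesis using False by (simp add: mult_le_cancel_left)
  qed simp
  let ?K = "\<lambda>X. gain_x A Bu R X *v v"
  have "(\<lambda>k. transpose Bu *v (Y k *v (A *v v)) - (R *v ?K X + transpose Bu *v (Y k *v (Bu *v ?K X))))
     \<longlonglongrightarrow> transpose Bu *v (X *v (A *v v)) - (R *v ?K X + transpose Bu *v (X *v (Bu *v ?K X)))"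
    by (intro tendsto_intros tendsto_matrix_vector lim)
  moreover have "transpose Bu *v (X *v (A *v v)) = R *v ?K X + transpose Bu *v (X *v (Bu *v ?K X))"
    using gain_x_normal_eq[OF assms(1) psd(2), where Bu = Bu and A = A and x = v]
    by (simp add: input_weight_def matrix_vector_mult_add_rdistrib flip: matrix_vector_mul_assoc)
  moreover have "transpose Bu *v (Y k *v (A *v v)) - (R *v ?K X + transpose Bu *v (Y k *v (Bu *v ?K X)))
      = input_weight Bu R (Y k) *v (?K (Y k) - ?K X)" for k
    using gain_x_normal_eq[OF assms(1) psd(1)[of k], where Bu = Bu and A = A and x = v]
    by (simp add: input_weight_def matrix_vector_mult_add_rdistrib matrix_vector_mult_diff_distrib flip: matrix_vector_mul_assoc)
  ultimately have "(\<lambda>k. input_weight Bu R (Y k) *v (?K (Y k) - ?K X)) \<longlonglongrightarrow> 0" by simp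
  then have "(\<lambda>k. norm (input_weight Bu R (Y k) *v (?K (Y k) - ?K X)) / r) \<longlonglongrightarrow> 0"
    using r(1) by (auto intro!: tendsto_eq_intros)
  then have "(\<lambda>k. ?K (Y k) - ?K X) \<longlonglongrightarrow> 0"
    by (rule Lim_null_comparison[rotated])
      (use low r(1) in \<open>auto simp: pos_le_divide_eq mult.commute\<close>)
  then show "(\<lambda>k. ?K (Y k)) \<longlonglongrightarrow> ?K X" by (rule LIM_zero_cancel)
qed

lemma stabilizing_dare_solution_iff:
  "stabilizing_dare_solution A Bu Q R X \<longleftrightarrow>
     psd X \<and> riccati A Bu Q R X = X \<and> schur (A - Bu ** gain_x A Bu R X)"
  unfolding stabilizing_dare_solution_def riccati_def input_weight_def
  by (auto simp: algebra_simps)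

lemma tendsto_closed_loop:
  assumes "(\<lambda>k. K k) \<longlonglongrightarrow> L"
  shows "(\<lambda>k. A - Bu ** K k) \<longlonglongrightarrow> A - Bu ** (L :: real^'x^'u)"
proof (rule tendsto_matrixI)
  fix v
  have "(\<lambda>k. A *v v - Bu *v (K k *v v)) \<longlonglongrightarrow> A *v v - Bu *v (L *v v)"
    by (intro tendsto_intros tendsto_matrix_vector assms)
  then show "(\<lambda>k. (A - Bu ** K k) *v v) \<longlonglongrightarrow> (A - Bu ** L) *v v"
    by (simp add: matrix_vector_mult_diff_rdistrib flip: matrix_vector_mul_assoc)
qed

text \<open>On the unit circle the Hermitian form of \<open>X\<close> is the same before and after one closed-loop
  step, so the stage cost of the step vanishes: \<open>Q v = 0\<close> and the gain vanishes on
  \<open>v\<close>. Then \<open>v\<close> is an eigenvector of \<open>A\<close> itself.\<close>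
lemma riccati_fixpoint_boundary:
  fixes A :: "real^'x^'x" and Bu :: "real^'u^'x"
  assumes "psd Q" "pd R" "psd X" and fp: "riccati A Bu Q R X = X"
    and ev: "eigenpair (A - Bu ** gain_x A Bu R X) z v" and "cmod z = 1"
  shows "unobservable_mode A Q z"
proof -
  let ?K = "gain_x A Bu R X"
  let ?a = "\<chi> i. Re (v $ i)" and ?b = "\<chi> i. Im (v $ i)"
  have "quad X ((A - Bu ** ?K) *v ?a) + quad X ((A - Bu ** ?K) *v ?b) = quad X ?a + quad X ?b"
    using eigenpair_quad[OF ev, of X] assms by (simp add: psd_def)
  then have "quad Q ?a + quad R (?K *v ?a) + quad Q ?b + quad R (?K *v ?b) = 0"
    using riccati_closed_loop[OF assms(2,3), where A = A and Bu = Bu and Q = Q and x = ?a] riccati_closed_loop[OF assms(2,3), where A = A and Bu = Bu and Q = Q and x = ?b]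
    by (simp add: fp)
  moreover have "0 \<le> quad Q x" "0 \<le> quad R y" for x y
    using assms(1) pd_imp_psd[OF assms(2)] by (auto simp: psd_def)
  ultimately have "quad Q ?a = 0" "quad Q ?b = 0" "quad R (?K *v ?a) = 0" "quad R (?K *v ?b) = 0"
    by (smt (verit))+
  then have Q0: "Q *v ?a = 0" "Q *v ?b = 0" and K0: "?K *v ?a = 0" "?K *v ?b = 0"
    using psd_quad_zero[OF assms(1)] assms(2) by (auto simp: pd_def)
  have split: "complex_mat M *v v = 0" if "M *v ?a = 0" "M *v ?b = 0" for M :: "real^'x^'m"
    using that by (auto simp: vec_eq_iff complex_eq_iff matrix_vector_mult_def complex_mat_def)
  have "complex_mat (A - Bu ** ?K) *v v = complex_mat A *v v - complex_mat (Bu ** ?K) *v v"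
    by (simp add: vec_eq_iff matrix_vector_mult_def complex_mat_def left_diff_distrib sum_subtractf)
  also have "complex_mat (Bu ** ?K) *v v = 0"
    by (rule split) (simp_all add: K0 flip: matrix_vector_mul_assoc)
  finally have "eigenpair A z v" using ev by (simp add: eigenpair_def)
  moreover have "complex_mat Q *v v = 0" by (rule split) (fact Q0)+
  ultimately show ?thesis by (auto simp: unobservable_mode_def)
qed

text \<open>The additional weight \<open>I/(k + 1)\<close> has two roles. It decreases, which together with
  monotonicity of the Riccati map keeps the iteration decreasing; and it is positive definite, which
  makes each iterate a strict Lyapunov function for its own closed loop.\<close>
theorem stabilizing_dare_solution_exists:
  fixes A :: "real^'x^'x" and Bu :: "real^'u^'x"
  assumes Q: "psd Q" and R: "pd R" and "stabilizable A Bu"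
    and obs: "\<And>z. cmod z = 1 \<Longrightarrow> \<not> unobservable_mode A Q z"
  shows "\<exists>X. stabilizing_dare_solution A Bu Q R X"
proof -
  obtain F where F: "schur (A - Bu ** F)" using assms(3) by (auto simp: stabilizable_def)
  define q where "q k = Q + (1 / real (Suc k)) *\<^sub>R mat 1" for k
  have quad_q: "quad (q k) x = quad Q x + 1 / real (Suc k) * (x \<bullet> x)" for k x
    by (simp add: q_def matrix_vector_mult_add_rdistrib inner_add_right flip: scaleR_matrix_vector_assoc)
  have psd_q: "psd (q k)" for k
  proof -
    have "transpose (q k) = q k" using Q by (simp add: q_def transpose_add psd_def transpose_scalar)
    then show ?thesis using Q by (simp add: psd_def quad_q)
  qed
  \<comment> \<open>\<open>P\<close> is the cost matrix of the feedback \<open>F\<close> for the weight \<open>q 0\<close>. One Riccati step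
   optimizes over \<open>u\<close> and can only lower it.\<close>
  obtain P where P: "psd P" "\<And>x. quad P x = quad P ((A - Bu ** F) *v x) + quad (q 0 + transpose F ** R ** F) x"
    using psd_lyapunov[OF F psd_add[OF psd_q psd_congruence[OF pd_imp_psd[OF R]]]] by metis
  define Y where "Y = rec_nat P (\<lambda>k X. riccati A Bu (q k) R X)"
  have Y0: "Y 0 = P" and YS: "\<And>k. Y (Suc k) = riccati A Bu (q k) R (Y k)" by (simp_all add: Y_def)
  have psd_Y: "psd (Y k)" for k
    by (induction k) (auto simp: Y0 YS P psd_riccati psd_q R)
  have dec: "quad (Y (Suc k)) x \<le> quad (Y k) x" for k x
  proof (induction k arbitrary: x)
    case 0
    have "quad (Y (Suc 0)) x \<le> quad (q 0) x + quad R (- (F *v x)) + quad P (A *v x + Bu *v (- (F *v x)))"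
      unfolding YS Y0 by (rule riccati_le[OF R P(1)])
    also have "\<dots> = quad P x"
      using P(2)[of x] by (simp add: inner_transpose matrix_vector_mult_add_rdistrib matrix_vector_mult_diff_rdistrib
          inner_add_right matrix_vector_neg flip: matrix_vector_mul_assoc)
    finally show ?case by (simp add: Y0)
  next
    case (Suc k)
    show ?case unfolding YS[of "Suc k"] YS[of k]
    proof (rule riccati_mono[OF R])
      show "quad (q (Suc k)) x \<le> quad (q k) x" for x
        unfolding quad_q by (intro add_left_mono mult_right_mono) (auto simp: divide_simps)
      show "quad (riccati A Bu (q k) R (Y k)) x \<le> quad (Y k) x" for x
        using Suc unfolding YS .
    qed (use psd_Y[of "Suc k"] psd_Y[of k] YS in auto)
  qed
  then have decseq: "decseq (\<lambda>k. quad (Y k) x)" for x by (auto simp: decseq_Suc_iff)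
  have "convergent (\<lambda>k. quad (Y k) x)" for x
    using decseq_convergent[OF decseq, of 0 x] psd_Y unfolding psd_def convergent_def by metis
  then obtain X where X: "Y \<longlonglongrightarrow> X" "transpose X = X" "\<And>x. (\<lambda>k. quad (Y k) x) \<longlonglongrightarrow> quad X x"
    using sym_matrix_convergent[of Y] psd_Y by (auto simp: psd_def)
  have "0 \<le> quad X x" for x
    by (rule LIMSEQ_le_const[OF X(3)]) (use psd_Y in \<open>auto simp: psd_def\<close>)
  then have psd_X: "psd X" using X(2) by (simp add: psd_def)
  have X_le: "quad X x \<le> quad (Y k) x" for k x by (rule decseq_ge[OF decseq X(3)])
  have q_lim: "(\<lambda>k. quad (q k) x) \<longlonglongrightarrow> quad Q x" for x
    unfolding quad_q by (rule tendsto_eq_intros refl LIMSEQ_Suc[OF lim_1_over_n])+ simp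
  \<comment> \<open>The fixed point equation survives the limit as two inequalities: monotonicity of the Riccati
   map gives one, its description as a minimum over \<open>u\<close> the other.\<close>
  have fp: "riccati A Bu Q R X = X"
  proof (rule sym_matrix_eqI)
    show "transpose (riccati A Bu Q R X) = riccati A Bu Q R X"
      using riccati_sym[OF _ R psd_X] Q by (simp add: psd_def)
    fix x
    have "quad (riccati A Bu Q R X) x \<le> quad (Y (Suc k)) x" for k
      unfolding YS by (rule riccati_mono[OF R psd_X psd_Y _ X_le]) (simp add: quad_q)
    then have "quad (riccati A Bu Q R X) x \<le> quad X x"
      by (intro LIMSEQ_le_const[OF LIMSEQ_Suc[OF X(3)]]) auto
    moreover have "quad X x \<le> quad Q x + quad R (- (gain_x A Bu R X *v x))
        + quad X (A *v x + Bu *v (- (gain_x A Bu R X *v x)))"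
    proof (rule LIMSEQ_le[OF LIMSEQ_Suc[OF X(3)]])
      show "(\<lambda>k. quad (q k) x + quad R (- (gain_x A Bu R X *v x))
          + quad (Y k) (A *v x + Bu *v (- (gain_x A Bu R X *v x)))) \<longlonglongrightarrow>
         quad Q x + quad R (- (gain_x A Bu R X *v x))
        + quad X (A *v x + Bu *v (- (gain_x A Bu R X *v x)))"
        by (intro tendsto_add q_lim X(3) tendsto_const)
      show "\<exists>N. \<forall>k\<ge>N. quad (Y (Suc k)) x \<le> quad (q k) x + quad R (- (gain_x A Bu R X *v x))
          + quad (Y k) (A *v x + Bu *v (- (gain_x A Bu R X *v x)))"
        unfolding YS using riccati_le[OF R psd_Y] by blast
    qed
    ultimately show "quad (riccati A Bu Q R X) x = quad X x"
      using riccati_completion[OF R psd_X, where Q = Q and x = x and u = "- (gain_x A Bu R X *v x)" and A = A and Bu = Bu] by simp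
  qed (rule X(2))
  have "schur (A - Bu ** gain_x A Bu R (Y k))" for k
  proof (rule schur_if_lyapunov_decrease[OF psd_Y[of k]])
    show "0 < 1 / real (Suc k)" by simp
    show "quad (Y k) ((A - Bu ** gain_x A Bu R (Y k)) *v x) + 1 / real (Suc k) * (x \<bullet> x) \<le> quad (Y k) x" for x
    proof -
      have "0 \<le> quad Q x" "0 \<le> quad R (gain_x A Bu R (Y k) *v x)"
        using Q pd_imp_psd[OF R] by (auto simp: psd_def)
      then show ?thesis
        using dec[where k = k and x = x] unfolding YS riccati_closed_loop[OF R psd_Y] quad_q by linarith
    qed
  qed
  moreover have "(\<lambda>k. A - Bu ** gain_x A Bu R (Y k)) \<longlonglongrightarrow> A - Bu ** gain_x A Bu R X"
    by (intro tendsto_closed_loop tendsto_gain_x R psd_Y psd_X X(1))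
  ultimately have "cmod z \<le> 1" if "eigenpair (A - Bu ** gain_x A Bu R X) z v" for z v
    by (rule schur_limit_eigenvalue[OF _ _ that])
  then have "schur (A - Bu ** gain_x A Bu R X)"
    using riccati_fixpoint_boundary[OF Q R psd_X fp] obs unfolding schur_def less_le by blast
  then show ?thesis using psd_X fp by (auto simp: stabilizing_dare_solution_iff)
qed

lemma schur_power_tendsto_zero:
  assumes "schur M"
  shows "(\<lambda>k. ((*v) M ^^ k) v) \<longlonglongrightarrow> 0"
proof -
  obtain C \<rho> where *: "power_bounded M C \<rho>" using schur_imp_power_bounded[OF assms] by blast
  have "(\<lambda>k. C * \<rho> ^ k * norm v) \<longlonglongrightarrow> C * 0 * norm v"
    using *
    by (intro tendsto_intros LIMSEQ_power_zero) (auto simp: power_bounded_def)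
  then have "(\<lambda>k. C * \<rho> ^ k * norm v) \<longlonglongrightarrow> 0" by simp
  then show ?thesis
    by (rule Lim_null_comparison[rotated])
      (use * in \<open>auto simp: power_bounded_def\<close>)
qed

text \<open>The difference \<open>D\<close> of two solutions satisfies \<open>D = M\<^sup>T D N\<close>, where \<open>M\<close> and \<open>N\<close> are the two
  closed-loop matrices. As both are Schur, iterating this equation gives \<open>D = 0\<close>.\<close>
lemma stabilizing_dare_solution_unique:
  fixes A :: "real^'x^'x" and Bu :: "real^'u^'x"
  assumes Q: "psd Q" and R: "pd R" and "stabilizing_dare_solution A Bu Q R X" "stabilizing_dare_solution A Bu Q R Y"
  shows "X = Y"
proof -
  have X: "psd X" "riccati A Bu Q R X = X" "schur (A - Bu ** gain_x A Bu R X)"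
    and Y: "psd Y" "riccati A Bu Q R Y = Y" "schur (A - Bu ** gain_x A Bu R Y)"
    using assms by (auto simp: stabilizing_dare_solution_iff)
  let ?M = "A - Bu ** gain_x A Bu R X" and ?N = "A - Bu ** gain_x A Bu R Y"
  have form: "x \<bullet> (Z *v y) = (A *v x) \<bullet> (Z *v ((A - Bu ** gain_x A Bu R Z) *v y)) + x \<bullet> (Q *v y)"
    if "psd Z" "riccati A Bu Q R Z = Z" for Z x y
  proof -
    have "Z *v y = transpose A *v (Z *v ((A - Bu ** gain_x A Bu R Z) *v y)) + Q *v y"
      by (subst (1) that(2)[symmetric])
        (simp add: riccati_def gain_x_def input_weight_def matrix_vector_mul_assoc matrix_mul_assoc
          matrix_vector_mult_add_rdistrib matrix_vector_mult_diff_rdistrib matrix_vector_mult_diff_distrib)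
    then show ?thesis by (simp add: inner_add_right inner_transpose)
  qed
  have normal: "(Bu *v u) \<bullet> (Z *v ((A - Bu ** gain_x A Bu R Z) *v y)) = u \<bullet> (R *v (gain_x A Bu R Z *v y))"
    if "psd Z" for Z u y
  proof -
    have "transpose Bu *v (Z *v ((A - Bu ** gain_x A Bu R Z) *v y)) = R *v (gain_x A Bu R Z *v y)"
      using gain_x_normal_eq[OF R that, where Bu = Bu and A = A and x = y]
      by (simp add: input_weight_def matrix_vector_mult_add_rdistrib matrix_vector_mult_diff_rdistrib
          matrix_vector_mult_diff_distrib algebra_simps flip: matrix_vector_mul_assoc)
    then show ?thesis by (metis inner_transpose)
  qed
  have symX: "transpose X = X" and symR: "transpose R = R" and symQ: "transpose Q = Q"
    using X R Q by (auto simp: psd_def pd_def)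
  have step: "x \<bullet> (X *v y) - x \<bullet> (Y *v y) = (?M *v x) \<bullet> (X *v (?N *v y)) - (?M *v x) \<bullet> (Y *v (?N *v y))" for x y
  proof -
    have Ay: "A *v y = ?N *v y + Bu *v (gain_x A Bu R Y *v y)"
      and Ax: "A *v x = ?M *v x + Bu *v (gain_x A Bu R X *v x)"
      by (simp_all add: matrix_vector_mult_diff_rdistrib flip: matrix_vector_mul_assoc)
    have "x \<bullet> (X *v y) = (A *v y) \<bullet> (X *v (?M *v x)) + x \<bullet> (Q *v y)"
      using form[OF X(1,2), of y x] by (simp add: sym_inner[OF symX, of x y] sym_inner[OF symQ, of x y])
    also have "(A *v y) \<bullet> (X *v (?M *v x)) = (?M *v x) \<bullet> (X *v (?N *v y))
        + (gain_x A Bu R Y *v y) \<bullet> (R *v (gain_x A Bu R X *v x))"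
      unfolding Ay inner_add_left normal[OF X(1)] by (simp only: sym_inner[OF symX, of "?N *v y"])
    finally have 1: "x \<bullet> (X *v y) = (?M *v x) \<bullet> (X *v (?N *v y))
        + (gain_x A Bu R Y *v y) \<bullet> (R *v (gain_x A Bu R X *v x)) + x \<bullet> (Q *v y)" .
    have 2: "x \<bullet> (Y *v y) = (?M *v x) \<bullet> (Y *v (?N *v y))
        + (gain_x A Bu R X *v x) \<bullet> (R *v (gain_x A Bu R Y *v y)) + x \<bullet> (Q *v y)"
      unfolding form[OF Y(1,2), of x y] Ax inner_add_left normal[OF Y(1)] ..
    show ?thesis unfolding 1 2 by (simp add: sym_inner[OF symR, of "gain_x A Bu R X *v x"])
  qed
  have "x \<bullet> (X *v y) - x \<bullet> (Y *v y) = 0" for x y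
  proof -
    let ?x = "\<lambda>k. ((*v) ?M ^^ k) x" and ?y = "\<lambda>k. ((*v) ?N ^^ k) y"
    have const: "x \<bullet> (X *v y) - x \<bullet> (Y *v y) = ?x k \<bullet> (X *v ?y k) - ?x k \<bullet> (Y *v ?y k)" for k
      by (induction k) (simp_all add: step[of "?x _"])
    have "(\<lambda>k. ?x k \<bullet> (X *v ?y k) - ?x k \<bullet> (Y *v ?y k)) \<longlonglongrightarrow> 0 \<bullet> (X *v 0) - 0 \<bullet> (Y *v 0)"
      by (intro tendsto_intros tendsto_matrix_vector schur_power_tendsto_zero X Y)
    then show ?thesis unfolding const[symmetric] by (simp add: LIMSEQ_const_iff)
  qed
  then have "(X *v y - Y *v y) \<bullet> (X *v y - Y *v y) = 0" for y by (simp only: inner_diff_right)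
  then show ?thesis by (simp add: matrix_eq)
qed

section \<open>Square-summable signals\<close>

text \<open>Convexity of the square for the weights \<open>\<rho>\<close> and \<open>1 - \<rho>\<close>. It turns a contractive linear
  recursion into a contractive recursion for squares.\<close>
lemma weighted_square_le:
  fixes a b \<rho> :: real
  assumes "0 \<le> \<rho>" "\<rho> < 1"
  shows "(\<rho> * a + b)\<^sup>2 \<le> \<rho> * a\<^sup>2 + b\<^sup>2 / (1 - \<rho>)"
proof -
  have "\<rho> * a\<^sup>2 + b\<^sup>2 / (1 - \<rho>) - (\<rho> * a + b)\<^sup>2 = \<rho> / (1 - \<rho>) * ((1 - \<rho>) * a - b)\<^sup>2"
    using assms by (simp add: divide_simps) (simp add: power2_eq_square algebra_simps)
  also have "\<dots> \<ge> 0" using assms by simp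
  finally show ?thesis by simp
qed

lemma forward_recursion_square_summable:
  fixes a b :: "nat \<Rightarrow> real"
  assumes \<rho>: "0 \<le> \<rho>" "\<rho> < 1" and nonneg: "\<And>t. 0 \<le> a t"
    and rec: "\<And>t. a (Suc t) \<le> \<rho> * a t + b t" and sb: "summable (\<lambda>t. (b t)\<^sup>2)"
  shows "summable (\<lambda>t. (a t)\<^sup>2)"
proof -
  define S where "S n = (\<Sum>t<n. (a t)\<^sup>2)" for n
  define B where "B = (\<Sum>t. (b t)\<^sup>2)"
  have step: "(a (Suc t))\<^sup>2 \<le> \<rho> * (a t)\<^sup>2 + (b t)\<^sup>2 / (1 - \<rho>)" for t
    by (rule order_trans[OF power_mono[OF rec nonneg] weighted_square_le[OF \<rho>]])
  have "S n \<le> ((a 0)\<^sup>2 + B / (1 - \<rho>)) / (1 - \<rho>)" for n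
  proof -
    have "S n \<le> S (Suc n)" by (simp add: S_def)
    also have "S (Suc n) = (a 0)\<^sup>2 + (\<Sum>t<n. (a (Suc t))\<^sup>2)"
      by (simp add: S_def sum.lessThan_Suc_shift del: sum.lessThan_Suc)
    also have "\<dots> \<le> (a 0)\<^sup>2 + (\<Sum>t<n. \<rho> * (a t)\<^sup>2 + (b t)\<^sup>2 / (1 - \<rho>))"
      by (intro add_left_mono sum_mono step)
    also have "\<dots> = (a 0)\<^sup>2 + \<rho> * S n + (\<Sum>t<n. (b t)\<^sup>2) / (1 - \<rho>)"
      by (simp add: S_def sum.distrib sum_distrib_left sum_divide_distrib)
    also have "\<dots> \<le> (a 0)\<^sup>2 + \<rho> * S n + B / (1 - \<rho>)"
      unfolding B_def using \<rho> by (intro add_left_mono divide_right_mono sum_le_suminf sb) auto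
    finally have "S n * (1 - \<rho>) \<le> (a 0)\<^sup>2 + B / (1 - \<rho>)" by (simp add: algebra_simps)
    then show ?thesis using \<rho> by (simp add: pos_le_divide_eq)
  qed
  then show ?thesis unfolding S_def by (intro summableI_nonneg_bounded) auto
qed

text \<open>Run backwards in time, a contraction alone does not determine the signal: for \<open>\<rho> > 0\<close>,
  \<open>a t = 1 / \<rho> ^ t\<close> satisfies the recursion with \<open>b = 0\<close>. The boundedness of \<open>a\<close> excludes this.\<close>
lemma backward_recursion_square_summable:
  fixes a b :: "nat \<Rightarrow> real"
  assumes \<rho>: "0 \<le> \<rho>" "\<rho> < 1" and nonneg: "\<And>t. 0 \<le> a t" and bd: "\<And>t. a t \<le> D"
    and rec: "\<And>t. a t \<le> \<rho> * a (Suc t) + b t" and sb: "summable (\<lambda>t. (b t)\<^sup>2)"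
  shows "summable (\<lambda>t. (a t)\<^sup>2)" and "(\<Sum>t. (a t)\<^sup>2) \<le> (\<Sum>t. (b t)\<^sup>2) / (1 - \<rho>)\<^sup>2"
proof -
  define S where "S n = (\<Sum>t<n. (a t)\<^sup>2)" for n
  define B where "B = (\<Sum>t. (b t)\<^sup>2)"
  have step: "(a t)\<^sup>2 \<le> \<rho> * (a (Suc t))\<^sup>2 + (b t)\<^sup>2 / (1 - \<rho>)" for t
    by (rule order_trans[OF power_mono[OF rec nonneg] weighted_square_le[OF \<rho>]])
  have S_le: "S n * (1 - \<rho>) \<le> (a n)\<^sup>2 + B / (1 - \<rho>)" for n
  proof -
    have "S n \<le> (\<Sum>t<n. \<rho> * (a (Suc t))\<^sup>2 + (b t)\<^sup>2 / (1 - \<rho>))"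
      unfolding S_def by (intro sum_mono step)
    also have "\<dots> = \<rho> * (\<Sum>t<n. (a (Suc t))\<^sup>2) + (\<Sum>t<n. (b t)\<^sup>2) / (1 - \<rho>)"
      by (simp add: sum.distrib sum_distrib_left sum_divide_distrib)
    also have "(\<Sum>t<n. (a (Suc t))\<^sup>2) = S (Suc n) - (a 0)\<^sup>2"
      by (simp add: S_def sum.lessThan_Suc_shift del: sum.lessThan_Suc)
    also have "\<rho> * (S (Suc n) - (a 0)\<^sup>2) + (\<Sum>t<n. (b t)\<^sup>2) / (1 - \<rho>) \<le> \<rho> * (S n + (a n)\<^sup>2) + B / (1 - \<rho>)"
      unfolding B_def using \<rho> by (intro add_mono mult_left_mono divide_right_mono sum_le_suminf sb) (auto simp: S_def)
    also have "\<dots> \<le> \<rho> * S n + (a n)\<^sup>2 + B / (1 - \<rho>)"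
      using \<rho> mult_right_mono[of \<rho> 1 "(a n)\<^sup>2"] by (simp add: distrib_left)
    finally show ?thesis by (simp add: algebra_simps)
  qed
  \<comment> \<open>A first crude bound gives summability, hence \<open>a n \<longlonglongrightarrow> 0\<close>, and this removes the boundary
   term from the estimate.\<close>
  have "S n \<le> (D\<^sup>2 + B / (1 - \<rho>)) / (1 - \<rho>)" for n
    using S_le[of n] power_mono[OF bd nonneg, of n 2] \<rho> by (simp add: pos_le_divide_eq)
  then show sa: "summable (\<lambda>t. (a t)\<^sup>2)" unfolding S_def by (intro summableI_nonneg_bounded) auto
  have "(\<lambda>n. S n * (1 - \<rho>)) \<longlonglongrightarrow> (\<Sum>t. (a t)\<^sup>2) * (1 - \<rho>)"
    unfolding S_def by (intro tendsto_intros summable_LIMSEQ sa)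
  moreover have "(\<lambda>n. (a n)\<^sup>2 + B / (1 - \<rho>)) \<longlonglongrightarrow> 0 + B / (1 - \<rho>)"
    by (intro tendsto_intros summable_LIMSEQ_zero sa)
  ultimately have "(\<Sum>t. (a t)\<^sup>2) * (1 - \<rho>) \<le> 0 + B / (1 - \<rho>)"
    by (rule LIMSEQ_le) (use S_le in auto)
  then show "(\<Sum>t. (a t)\<^sup>2) \<le> (\<Sum>t. (b t)\<^sup>2) / (1 - \<rho>)\<^sup>2"
    using \<rho> by (simp add: B_def pos_le_divide_eq power2_eq_square mult.assoc[symmetric])
qed

text \<open>The power bound for \<open>M\<close> allows \<open>\<parallel>M\<parallel> > 1\<close> because of the factor \<open>C\<close>. In the equivalent norm
  \<open>sup\<^sub>k \<parallel>M\<^sup>k v\<parallel> / \<rho>\<^sup>k\<close> one step already contracts, so that vector recursions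
  reduce to scalar ones.\<close>
lemma adapted_norm_exists:
  fixes M :: "real^'n^'n"
  assumes pb: "power_bounded M C \<rho>"
  shows "\<exists>N :: real^'n \<Rightarrow> real. (\<forall>v. norm v \<le> N v \<and> N v \<le> C * norm v) \<and>
    (\<forall>u v. N (u + v) \<le> N u + N v) \<and> (\<forall>v. N (M *v v) \<le> \<rho> * N v)"
proof -
  define N where "N v = (SUP k. norm (((*v) M ^^ k) v) / \<rho> ^ k)" for v
  have \<rho>: "0 < \<rho>" using pb by (simp add: power_bounded_def)
  have geom: "norm (((*v) M ^^ k) v) / \<rho> ^ k \<le> C * norm v" for k v
    using pb \<rho> by (simp add: power_bounded_def pos_divide_le_eq mult_ac)
  then have bdd: "bdd_above (range (\<lambda>k. norm (((*v) M ^^ k) v) / \<rho> ^ k))" for v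
    by (intro bdd_aboveI2) auto
  have up: "norm (((*v) M ^^ k) v) / \<rho> ^ k \<le> N v" for k v
    unfolding N_def by (rule cSUP_upper[OF UNIV_I bdd])
  have "norm v \<le> N v" for v using up[of 0 v] by simp
  moreover have "N v \<le> C * norm v" for v unfolding N_def by (rule cSUP_least) (use geom in auto)
  moreover have "N (u + v) \<le> N u + N v" for u v
    unfolding N_def[of "u + v"]
  proof (rule cSUP_least)
    fix k
    have "((*v) M ^^ k) (u + v) = ((*v) M ^^ k) u + ((*v) M ^^ k) v"
      by (induction k) (simp_all add: matrix_vector_right_distrib)
    then have "norm (((*v) M ^^ k) (u + v)) / \<rho> ^ k
        \<le> norm (((*v) M ^^ k) u) / \<rho> ^ k + norm (((*v) M ^^ k) v) / \<rho> ^ k"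
      using \<rho> by (simp add: norm_triangle_ineq divide_right_mono flip: add_divide_distrib)
    also have "\<dots> \<le> N u + N v" by (intro add_mono up)
    finally show "norm (((*v) M ^^ k) (u + v)) / \<rho> ^ k \<le> N u + N v" .
  qed simp
  moreover have "N (M *v v) \<le> \<rho> * N v" for v
    unfolding N_def[of "M *v v"]
  proof (rule cSUP_least)
    fix k
    show "norm (((*v) M ^^ k) (M *v v)) / \<rho> ^ k \<le> \<rho> * N v"
      using up[where k = "Suc k" and v = v] \<rho> by (simp add: funpow_swap1 divide_simps mult_ac)
  qed simp
  ultimately show ?thesis by (intro exI[of _ N]) blast
qed

lemma l2_add:
  assumes "l2 u" "l2 v" shows "l2 (\<lambda>t. u t + v t)"
proof -
  have bd: "(norm (u t + v t))\<^sup>2 \<le> 2 * (norm (u t))\<^sup>2 + 2 * (norm (v t))\<^sup>2" for t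
  proof -
    have "(norm (u t + v t))\<^sup>2 \<le> (norm (u t) + norm (v t))\<^sup>2"
      by (intro power_mono norm_triangle_ineq) simp
    also have "\<dots> \<le> 2 * (norm (u t))\<^sup>2 + 2 * (norm (v t))\<^sup>2"
      using sum_squares_bound[of "norm (u t)" "norm (v t)"] by (simp add: power2_sum)
    finally show ?thesis .
  qed
  show ?thesis unfolding l2_def
    by (rule summable_comparison_test'[of "\<lambda>t. 2 * (norm (u t))\<^sup>2 + 2 * (norm (v t))\<^sup>2" 0])
      (use assms bd in \<open>auto simp: l2_def intro!: summable_add summable_mult\<close>)
qed

lemma matrix_norm_bound:
  fixes M :: "real^'n^'m"
  obtains L where "0 \<le> L" "\<And>v. norm (M *v v) \<le> L * norm v"
  using bounded_linear.nonneg_bounded[OF matrix_vector_mul_bounded_linear[of M]]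
  by (metis mult.commute)

lemma l2_norm_bounded:
  assumes "l2 u" "\<And>t. norm (v t) \<le> L * norm (u t)"
  shows "l2 v" and "l2_norm_sq v \<le> L\<^sup>2 * l2_norm_sq u"
proof -
  have bd: "(norm (v t))\<^sup>2 \<le> L\<^sup>2 * (norm (u t))\<^sup>2" for t
    using power_mono[OF assms(2) norm_ge_zero, of t 2] by (simp add: power_mult_distrib)
  show v: "l2 v" unfolding l2_def
    by (rule summable_comparison_test'[of "\<lambda>t. L\<^sup>2 * (norm (u t))\<^sup>2" 0])
      (use assms(1) bd in \<open>auto simp: l2_def intro!: summable_mult\<close>)
  show "l2_norm_sq v \<le> L\<^sup>2 * l2_norm_sq u"
    using v assms(1) bd unfolding l2_norm_sq_def l2_def
    by (subst suminf_mult[symmetric]) (auto intro!: suminf_le summable_mult)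
qed

lemma l2_matrix:
  fixes M :: "real^'n^'m"
  assumes "l2 u" shows "l2 (\<lambda>t. M *v u t)"
proof -
  obtain L where L: "\<And>v. norm (M *v v) \<le> L * norm v" using matrix_norm_bound[of M] by blast
  show ?thesis by (rule l2_norm_bounded(1)[OF assms L])
qed

lemma l2_minus: "l2 u \<Longrightarrow> l2 (\<lambda>t. - u t)"
  by (simp add: l2_def)

lemma l2_diff: "l2 u \<Longrightarrow> l2 v \<Longrightarrow> l2 (\<lambda>t. u t - v t)"
  using l2_add[OF _ l2_minus, of u v] by simp

lemma l2_shift:
  assumes "l2 u" shows "l2 (\<lambda>t. u (t + m))" and "l2_norm_sq (\<lambda>t. u (t + m)) \<le> l2_norm_sq u"
proof -
  show "l2 (\<lambda>t. u (t + m))" using assms by (simp add: l2_def summable_iff_shift[of "\<lambda>t. (norm (u t))\<^sup>2"])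
  show "l2_norm_sq (\<lambda>t. u (t + m)) \<le> l2_norm_sq u"
    using assms suminf_split_initial_segment[of "\<lambda>t. (norm (u t))\<^sup>2" m]
    by (simp add: l2_def l2_norm_sq_def sum_nonneg)
qed

lemma l2_tendsto_zero:
  assumes "l2 u" shows "u \<longlonglongrightarrow> 0"
proof -
  have "(\<lambda>t. sqrt ((norm (u t))\<^sup>2)) \<longlonglongrightarrow> sqrt 0"
    using assms by (intro tendsto_intros summable_LIMSEQ_zero) (simp add: l2_def)
  then show ?thesis by (simp add: tendsto_norm_zero_iff)
qed

lemma l2_inner_summable:
  assumes "l2 u" "l2 v" shows "summable (\<lambda>t. u t \<bullet> v t)"
proof (rule summable_comparison_test'[of "\<lambda>t. (norm (u t))\<^sup>2 + (norm (v t))\<^sup>2" 0])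
  show "summable (\<lambda>t. (norm (u t))\<^sup>2 + (norm (v t))\<^sup>2)"
    using assms by (intro summable_add) (auto simp: l2_def)
  fix t
  have "norm (u t \<bullet> v t) \<le> norm (u t) * norm (v t)" by (simp add: Cauchy_Schwarz_ineq2)
  also have "\<dots> \<le> (norm (u t))\<^sup>2 + (norm (v t))\<^sup>2"
    using sum_squares_bound[of "norm (u t)" "norm (v t)"]
      mult_nonneg_nonneg[OF norm_ge_zero norm_ge_zero, of "u t" "v t"] by linarith
  finally show "norm (u t \<bullet> v t) \<le> (norm (u t))\<^sup>2 + (norm (v t))\<^sup>2" .
qed

lemma l2_forward_recursion:
  fixes M :: "real^'n^'n"
  assumes "power_bounded M C \<rho>" and rec: "\<And>t. x (Suc t) = M *v x t + f t" and "l2 f"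
  shows "l2 x"
proof -
  obtain N where N: "\<And>v. norm v \<le> N v" "\<And>v. N v \<le> C * norm v" "\<And>u v. N (u + v) \<le> N u + N v"
    "\<And>v. N (M *v v) \<le> \<rho> * N v" using adapted_norm_exists[OF assms(1)] by blast
  have N0: "0 \<le> N v" for v using N(1)[of v] norm_ge_zero order_trans by blast
  have \<rho>: "0 \<le> \<rho>" "\<rho> < 1" using assms(1) by (auto simp: power_bounded_def)
  have "summable (\<lambda>t. (N (x t))\<^sup>2)"
  proof (rule forward_recursion_square_summable[OF \<rho>])
    show "N (x (Suc t)) \<le> \<rho> * N (x t) + C * norm (f t)" for t
      unfolding rec by (rule order_trans[OF N(3) add_mono[OF N(4) N(2)]])
    show "summable (\<lambda>t. (C * norm (f t))\<^sup>2)"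
      unfolding power_mult_distrib using assms(3) by (intro summable_mult) (simp add: l2_def)
  qed (rule N0)
  then show ?thesis unfolding l2_def
    by (rule summable_comparison_test') (auto intro: power_mono N(1))
qed

text \<open>For a power bounded \<open>M\<close> and square-summable \<open>y\<close>, this is the bounded solution of the
  anticausal recursion \<open>g(t) = y(t) + M g(t + 1)\<close>.\<close>
definition discounted_future :: "real^'n^'n \<Rightarrow> (nat \<Rightarrow> real^'n) \<Rightarrow> nat \<Rightarrow> real^'n" where
  "discounted_future M y t = (\<Sum>k. ((*v) M ^^ k) (y (t + k)))"

lemma funpow_matrix_bounded_linear: "bounded_linear ((*v) M ^^ k)" for M :: "real^'n^'n"
proof (induction k)
  case (Suc k)
  then show ?case using bounded_linear_compose[OF matrix_vector_mul_bounded_linear[of M] Suc]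
    by (simp add: o_def)
qed (simp add: bounded_linear_ident id_def)

lemma discounted_future_summable:
  assumes "power_bounded M C \<rho>" "l2 y"
  shows "summable (\<lambda>k. ((*v) M ^^ k) (y (t + k)))"
    and "\<exists>D. \<forall>t. norm (discounted_future M y t) \<le> D"
proof -
  obtain B where B: "\<And>t. norm (y t) \<le> B"
    using l2_tendsto_zero[OF assms(2)] by (meson convergentI convergent_imp_Bseq BseqE)
  have pb: "0 < C" "0 < \<rho>" "\<rho> < 1" "\<And>k v. norm (((*v) M ^^ k) v) \<le> C * \<rho> ^ k * norm v"
    using assms(1) by (auto simp: power_bounded_def)
  have bd: "norm (((*v) M ^^ k) (y (t + k))) \<le> C * B * \<rho> ^ k" for k t
  proof -
    have "norm (((*v) M ^^ k) (y (t + k))) \<le> C * \<rho> ^ k * norm (y (t + k))" by (rule pb(4))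
    also have "\<dots> \<le> C * \<rho> ^ k * B" using pb B by (intro mult_left_mono) auto
    finally show ?thesis by (simp add: mult_ac)
  qed
  have sg: "summable (\<lambda>k. C * B * \<rho> ^ k)" using pb by (intro summable_mult summable_geometric) auto
  have sn: "summable (\<lambda>k. norm (((*v) M ^^ k) (y (t + k))))" for t
    by (rule summable_comparison_test'[OF sg, of 0]) (use bd in auto)
  then show "summable (\<lambda>k. ((*v) M ^^ k) (y (t + k)))" by (rule summable_norm_cancel)
  have "norm (discounted_future M y t) \<le> (\<Sum>k. C * B * \<rho> ^ k)" for t
    unfolding discounted_future_def
    by (rule order_trans[OF summable_norm[OF sn] suminf_le[OF bd sn sg]])
  then show "\<exists>D. \<forall>t. norm (discounted_future M y t) \<le> D" by blast
qed

text \<open>Truncating the sum leaves a tail that is a whole later value, contracted by \<open>M\<^sup>m\<close>. This is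
  the reason why finite preview is nearly as good as infinite preview.\<close>
lemma discounted_future_split:
  assumes "power_bounded M C \<rho>" "l2 y"
  shows "discounted_future M y t
     = (\<Sum>k<m. ((*v) M ^^ k) (y (t + k))) + ((*v) M ^^ m) (discounted_future M y (t + m))"
proof -
  have pow: "((*v) M ^^ m) (((*v) M ^^ k) v) = ((*v) M ^^ (k + m)) v" for k v
    by (simp add: add.commute[of k] funpow_add)
  have "((*v) M ^^ m) (discounted_future M y (t + m)) = (\<Sum>k. ((*v) M ^^ m) (((*v) M ^^ k) (y (t + m + k))))"
    unfolding discounted_future_def
    by (rule bounded_linear.suminf[OF funpow_matrix_bounded_linear discounted_future_summable(1)[OF assms]])
  also have "\<dots> = (\<Sum>k. ((*v) M ^^ (k + m)) (y (t + (k + m))))"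
    by (simp add: pow ac_simps)
  finally have "((*v) M ^^ m) (discounted_future M y (t + m)) = (\<Sum>k. ((*v) M ^^ (k + m)) (y (t + (k + m))))" .
  then show ?thesis
    unfolding discounted_future_def[of M y t]
    by (subst suminf_split_initial_segment[OF discounted_future_summable(1)[OF assms], of _ m]) simp
qed

lemma discounted_future_rec:
  assumes "power_bounded M C \<rho>" "l2 y"
  shows "discounted_future M y t = y t + M *v discounted_future M y (Suc t)"
  using discounted_future_split[OF assms, of t 1] by simp

lemma discounted_future_l2:
  fixes M :: "real^'n^'n"
  assumes pb: "power_bounded M C \<rho>" and "l2 y"
  shows "l2 (discounted_future M y)"
    and "l2_norm_sq (discounted_future M y) \<le> (C / (1 - \<rho>))\<^sup>2 * l2_norm_sq y"
proof -
  let ?g = "discounted_future M y"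
  obtain N where N: "\<And>v. norm v \<le> N v" "\<And>v. N v \<le> C * norm v" "\<And>u v. N (u + v) \<le> N u + N v"
    "\<And>v. N (M *v v) \<le> \<rho> * N v" using adapted_norm_exists[OF pb] by blast
  have N0: "0 \<le> N v" for v using N(1)[of v] norm_ge_zero order_trans by blast
  have \<rho>: "0 \<le> \<rho>" "\<rho> < 1" "0 < C" using pb by (auto simp: power_bounded_def)
  obtain D where D: "\<And>t. norm (?g t) \<le> D" using discounted_future_summable(2)[OF assms] by blast
  have 1: "N (?g t) \<le> C * D" for t
    using \<rho> by (intro order_trans[OF N(2)] mult_left_mono D) auto
  have 2: "N (?g t) \<le> \<rho> * N (?g (Suc t)) + C * norm (y t)" for t
    by (subst discounted_future_rec[OF assms])
      (rule order_trans[OF N(3)], use add_mono[OF N(2) N(4)] in \<open>simp add: add.commute\<close>)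
  have 3: "summable (\<lambda>t. (C * norm (y t))\<^sup>2)"
    unfolding power_mult_distrib using assms(2) by (intro summable_mult) (simp add: l2_def)
  note bw = backward_recursion_square_summable[OF \<rho>(1,2) N0 1 2 3]
  have le: "(norm (?g t))\<^sup>2 \<le> (N (?g t))\<^sup>2" for t by (intro power_mono N(1)) simp
  show l2: "l2 ?g" unfolding l2_def
    by (rule summable_comparison_test'[OF bw(1), of 0]) (use le in auto)
  have "l2_norm_sq ?g \<le> (\<Sum>t. (N (?g t))\<^sup>2)"
    unfolding l2_norm_sq_def using l2 by (intro suminf_le le bw(1)) (simp add: l2_def)
  also have "\<dots> \<le> (\<Sum>t. (C * norm (y t))\<^sup>2) / (1 - \<rho>)\<^sup>2" by (rule bw(2))
  also have "\<dots> = (C / (1 - \<rho>))\<^sup>2 * l2_norm_sq y"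
    using assms(2) by (simp add: power_mult_distrib power_divide l2_norm_sq_def l2_def suminf_mult)
  finally show "l2_norm_sq ?g \<le> (C / (1 - \<rho>))\<^sup>2 * l2_norm_sq y" .
qed

lemma quad_bound:
  fixes M :: "real^'n^'n"
  obtains L where "0 \<le> L" "\<And>v. \<bar>quad M v\<bar> \<le> L * (norm v)\<^sup>2"
proof -
  obtain L where L: "0 \<le> L" "\<And>v. norm (M *v v) \<le> L * norm v" using matrix_norm_bound[of M] by blast
  have "\<bar>quad M v\<bar> \<le> L * (norm v)\<^sup>2" for v
  proof -
    have "\<bar>quad M v\<bar> \<le> norm v * norm (M *v v)" by (rule Cauchy_Schwarz_ineq2)
    also have "\<dots> \<le> norm v * (L * norm v)" by (intro mult_left_mono L) simp
    finally show ?thesis by (simp add: power2_eq_square mult_ac)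
  qed
  with L(1) show ?thesis by (rule that)
qed

lemma quad_summable: "l2 x \<Longrightarrow> summable (\<lambda>t. quad M (x t))"
  by (rule l2_inner_summable[OF _ l2_matrix])

lemma quad_suminf_bound:
  fixes M :: "real^'n^'n"
  assumes "\<And>v. \<bar>quad M v\<bar> \<le> L * (norm v)\<^sup>2" "l2 x"
  shows "(\<Sum>t. quad M (x t)) \<le> L * l2_norm_sq x"
proof -
  have "(\<Sum>t. quad M (x t)) \<le> (\<Sum>t. L * (norm (x t))\<^sup>2)"
    using assms(2) by (intro suminf_le quad_summable summable_mult order_trans[OF abs_ge_self assms(1)]) (auto simp: l2_def)
  also have "\<dots> = L * l2_norm_sq x"
    using assms(2) by (simp add: l2_norm_sq_def l2_def suminf_mult)
  finally show ?thesis .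
qed

section \<open>The cost of a trajectory relative to the non-causal law\<close>

lemma cl_state_0: "cl_state A Bu Bd K x0 d 0 = x0"
  by (simp add: cl_state_def)

lemma cl_state_Suc:
  "cl_state A Bu Bd K x0 d (Suc t) =
     A *v cl_state A Bu Bd K x0 d t + Bd *v d t + Bu *v cl_input A Bu Bd K x0 d t"
  by (simp add: cl_state_def cl_input_def Let_def)

lemma length_state_history: "length (state_history A Bu Bd K x0 d t) = Suc t"
  by (induction t) (simp_all add: Let_def)

text \<open>Stability of the closed loop enters through an explicit decay bound because its constants
  \<open>C\<close> and \<open>\<rho>\<close> govern the loss by truncation.\<close>
locale riccati_loop =
  fixes A :: "real^'x^'x" and Bu :: "real^'u^'x" and Bd :: "real^'d^'x"
    and Q :: "real^'x^'x" and R :: "real^'u^'u" and X :: "real^'x^'x" and C \<rho> :: real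
  assumes R: "pd R" and X: "psd X" and fixpoint: "riccati A Bu Q R X = X"
    and decay: "power_bounded (A - Bu ** gain_x A Bu R X) C \<rho>"
begin

abbreviation "Kx \<equiv> gain_x A Bu R X"
abbreviation "Kv \<equiv> gain_v Bu R X"
abbreviation "At \<equiv> A - Bu ** Kx"
abbreviation "H \<equiv> input_weight Bu R X"

lemma decay': "power_bounded (transpose At) C \<rho>"
  by (rule power_bounded_transpose[OF decay])

definition costate :: "(nat \<Rightarrow> real^'d) \<Rightarrow> nat \<Rightarrow> real^'x" where
  "costate d = discounted_future (transpose At) (\<lambda>t. X *v (Bd *v d t))"

text \<open>The share of stage \<open>t\<close> in the part of the cost that no input can influence. Single terms
  may be negative; only the sum over all \<open>t\<close> is a cost.\<close>
definition unavoidable_cost :: "(nat \<Rightarrow> real^'d) \<Rightarrow> nat \<Rightarrow> real" where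
  "unavoidable_cost d t = quad X (Bd *v d t)
     + 2 * ((Bd *v d t) \<bullet> (transpose At *v costate d (Suc t)))
     - quad H (Kv *v costate d t)"

lemma quad_H_nonneg: "0 \<le> quad H v"
  using pd_imp_psd[OF pd_input_weight[OF R X]] by (simp add: psd_def)

lemma costate_l2: "l2 d \<Longrightarrow> l2 (costate d)"
  unfolding costate_def by (intro discounted_future_l2(1)[OF decay'] l2_matrix)

lemma costate_rec: "l2 d \<Longrightarrow> costate d t = X *v (Bd *v d t) + transpose At *v costate d (Suc t)"
  unfolding costate_def by (rule discounted_future_rec[OF decay' l2_matrix[OF l2_matrix]])

lemma costate_bound:
  obtains G where "0 \<le> G" "\<And>d. l2 d \<Longrightarrow> l2_norm_sq (costate d) \<le> G * l2_norm_sq d"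
proof -
  obtain L where L: "\<And>v. norm ((X ** Bd) *v v) \<le> L * norm v" using matrix_norm_bound[of "X ** Bd"] by blast
  have "l2_norm_sq (costate d) \<le> ((C / (1 - \<rho>))\<^sup>2 * L\<^sup>2) * l2_norm_sq d" if "l2 d" for d
  proof -
    have "norm (X *v (Bd *v d t)) \<le> L * norm (d t)" for t
      using L[of "d t"] by (simp add: matrix_vector_mul_assoc)
    note y = l2_norm_bounded[OF that this]
    have "l2_norm_sq (costate d) \<le> (C / (1 - \<rho>))\<^sup>2 * l2_norm_sq (\<lambda>t. X *v (Bd *v d t))"
      unfolding costate_def by (rule discounted_future_l2(2)[OF decay' y(1)])
    also have "\<dots> \<le> (C / (1 - \<rho>))\<^sup>2 * (L\<^sup>2 * l2_norm_sq d)" by (intro mult_left_mono y(2)) simp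
    finally show ?thesis by simp
  qed
  then show ?thesis by (intro that[of "(C / (1 - \<rho>))\<^sup>2 * L\<^sup>2"]) simp_all
qed

lemma unavoidable_cost_summable: "l2 d \<Longrightarrow> summable (unavoidable_cost d)"
  unfolding unavoidable_cost_def[abs_def]
  using l2_shift(1)[OF costate_l2, of d 1]
  by (intro summable_diff summable_add summable_mult quad_summable l2_inner_summable l2_matrix costate_l2) simp_all

lemma unavoidable_cost_bound:
  obtains L where "0 \<le> L" "\<And>d. l2 d \<Longrightarrow> (\<Sum>t. unavoidable_cost d t) \<le> L * l2_norm_sq d"
proof -
  obtain G where G: "0 \<le> G" "\<And>d. l2 d \<Longrightarrow> l2_norm_sq (costate d) \<le> G * l2_norm_sq d"
    using costate_bound by blast
  obtain LX where LX: "0 \<le> LX" "\<And>v. \<bar>quad X v\<bar> \<le> LX * (norm v)\<^sup>2" using quad_bound[of X] by blast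
  obtain LB where LB: "\<And>v. norm (Bd *v v) \<le> LB * norm v" using matrix_norm_bound[of Bd] by blast
  obtain LA where LA: "\<And>v. norm (transpose At *v v) \<le> LA * norm v" using matrix_norm_bound[of "transpose At"] by blast
  have "(\<Sum>t. unavoidable_cost d t) \<le> ((LX + 1) * LB\<^sup>2 + LA\<^sup>2 * G) * l2_norm_sq d" if d: "l2 d" for d
  proof -
    let ?w = "\<lambda>t. Bd *v d t" and ?s = "\<lambda>t. transpose At *v costate d (Suc t)"
    have w: "l2 ?w" "l2_norm_sq ?w \<le> LB\<^sup>2 * l2_norm_sq d" using l2_norm_bounded[OF d LB] by auto
    have c1: "l2 (\<lambda>t. costate d (Suc t))" "l2_norm_sq (\<lambda>t. costate d (Suc t)) \<le> G * l2_norm_sq d"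
      using l2_shift[OF costate_l2[OF d], of 1] G(2)[OF d] by auto
    have s: "l2 ?s" "l2_norm_sq ?s \<le> LA\<^sup>2 * (G * l2_norm_sq d)"
      using l2_norm_bounded[OF c1(1) LA] mult_left_mono[OF c1(2), of "LA\<^sup>2"] by auto
    have bd: "unavoidable_cost d t \<le> (LX + 1) * (norm (?w t))\<^sup>2 + (norm (?s t))\<^sup>2" for t
    proof -
      have "2 * (?w t \<bullet> ?s t) \<le> (norm (?w t))\<^sup>2 + (norm (?s t))\<^sup>2"
        using norm_cauchy_schwarz[of "?w t" "?s t"] sum_squares_bound[of "norm (?w t)" "norm (?s t)"] by linarith
      moreover have "quad X (?w t) \<le> LX * (norm (?w t))\<^sup>2" using LX(2) abs_ge_self order_trans by blast
      ultimately show ?thesis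
        unfolding unavoidable_cost_def using quad_H_nonneg[of "Kv *v costate d t"] by (simp add: distrib_right)
    qed
    have sw: "summable (\<lambda>t. (norm (?w t))\<^sup>2)" and ss: "summable (\<lambda>t. (norm (?s t))\<^sup>2)"
      using w s by (auto simp: l2_def)
    have "(\<Sum>t. unavoidable_cost d t) \<le> (\<Sum>t. (LX + 1) * (norm (?w t))\<^sup>2 + (norm (?s t))\<^sup>2)"
      by (intro suminf_le bd unavoidable_cost_summable[OF d] summable_add summable_mult sw ss)
    also have "\<dots> = (LX + 1) * l2_norm_sq ?w + l2_norm_sq ?s"
      unfolding l2_norm_sq_def suminf_mult[OF sw, symmetric]
      by (rule suminf_add[OF summable_mult[OF sw] ss, symmetric])
    also have "\<dots> \<le> (LX + 1) * (LB\<^sup>2 * l2_norm_sq d) + LA\<^sup>2 * (G * l2_norm_sq d)"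
      using LX(1) by (intro add_mono mult_left_mono w s) auto
    finally show ?thesis by (simp add: algebra_simps)
  qed
  then show ?thesis using G LX by (intro that[of "(LX + 1) * LB\<^sup>2 + LA\<^sup>2 * G"]) simp_all
qed

text \<open>The cost-to-go \<open>V t = x(t)\<^sup>T X x(t) + 2 x(t)\<^sup>T At\<^sup>T g(t)\<close> telescopes: it is \<open>0\<close> at the start
  because \<open>x(0) = 0\<close>, and tends to \<open>0\<close> because the signals are square-summable. What remains
  of the completed squares is the deviation from the non-causal law and a term in \<open>d\<close>
  alone.\<close>
lemma cost_decomposition:
  assumes d: "l2 d" and x: "l2 x" and u: "l2 u" and x0: "x 0 = 0"
    and rec: "\<And>t. x (Suc t) = A *v x t + Bd *v d t + Bu *v u t"
  shows "(\<Sum>t. quad Q (x t) + quad R (u t)) =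
     (\<Sum>t. quad H (u t + Kx *v x t + Kv *v costate d t)) + (\<Sum>t. unavoidable_cost d t)"
proof -
  let ?s = "\<lambda>t. transpose At *v costate d t"
  let ?e = "\<lambda>t. u t + Kx *v x t + Kv *v costate d t"
  define V where "V t = quad X (x t) + 2 * (x t \<bullet> ?s t)" for t
  have e: "l2 ?e" by (intro l2_add l2_matrix u x costate_l2 d)
  have eq: "quad Q (x t) + quad R (u t) = (quad H (?e t) + unavoidable_cost d t) + (V t - V (Suc t))" for t
    using complete_square[OF R X, where Q = Q and x = "x t" and u = "u t" and A = A and Bu = Bu
        and w = "Bd *v d t" and s = "?s (Suc t)"]
    by (simp add: fixpoint rec[of t] V_def unavoidable_cost_def flip: costate_rec[OF d])
  have "V \<longlonglongrightarrow> 0 \<bullet> (X *v 0) + 2 * (0 \<bullet> (transpose At *v 0))"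
    unfolding V_def
    by (intro tendsto_add tendsto_mult tendsto_const tendsto_inner tendsto_matrix_vector
        l2_tendsto_zero x costate_l2 d)
  then have "V \<longlonglongrightarrow> 0" by simp
  from telescope_sums'[OF this] have "(\<lambda>t. V t - V (Suc t)) sums 0" by (simp add: V_def x0)
  then have "(\<lambda>t. quad Q (x t) + quad R (u t)) sums
      (((\<Sum>t. quad H (?e t)) + (\<Sum>t. unavoidable_cost d t)) + 0)"
    unfolding eq by (intro sums_add summable_sums quad_summable e unavoidable_cost_summable d)
  then show ?thesis by (simp add: sums_iff)
qed

lemma stabilizing_cost:
  assumes "stabilizing A Bu Bd K" "l2 d"
  shows "cost A Bu Bd Q R K d =
     (\<Sum>t. quad H (cl_input A Bu Bd K 0 d t + Kx *v cl_state A Bu Bd K 0 d t + Kv *v costate d t))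
     + (\<Sum>t. unavoidable_cost d t)"
  unfolding cost_def
  using assms by (intro cost_decomposition) (auto simp: stabilizing_def cl_state_0 cl_state_Suc)

text \<open>The weight \<open>H\<close> of the deviation is positive definite. The bound is attained by the non-causal
  law, whose deviation vanishes (\<open>optimal_cost\<close>); it is thus optimal disturbance by disturbance
  among all stabilizing controllers, nonlinear and time-varying ones included.\<close>
lemma unavoidable_cost_le:
  assumes "stabilizing A Bu Bd K" "l2 d"
  shows "(\<Sum>t. unavoidable_cost d t) \<le> cost A Bu Bd Q R K d"
proof -
  have "l2 (\<lambda>t. cl_input A Bu Bd K 0 d t + Kx *v cl_state A Bu Bd K 0 d t + Kv *v costate d t)"
    using assms by (intro l2_add l2_matrix costate_l2) (auto simp: stabilizing_def)
  then show ?thesis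
    unfolding stabilizing_cost[OF assms] using suminf_nonneg[OF quad_summable quad_H_nonneg] by simp
qed

section \<open>Truncated feedforward\<close>

text \<open>The non-causal controller and its truncations differ only in the signal \<open>h\<close>. The time is
  recovered from the length of the state history.\<close>
definition feedforward :: "((nat \<Rightarrow> real^'d) \<Rightarrow> nat \<Rightarrow> real^'x) \<Rightarrow> ('x, 'u, 'd) controller" where
  "feedforward h = (\<lambda>xs d. - (Kx *v last xs) - Kv *v h d (length xs - 1))"

lemma feedforward_input:
  "cl_input A Bu Bd (feedforward h) x0 d t =
     - (Kx *v cl_state A Bu Bd (feedforward h) x0 d t) - Kv *v h d t"
  by (simp add: cl_input_def cl_state_def feedforward_def length_state_history)

lemma feedforward_stabilizing:
  assumes "\<And>d. l2 d \<Longrightarrow> l2 (h d)"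
  shows "stabilizing A Bu Bd (feedforward h)"
  unfolding stabilizing_def
proof (intro allI impI)
  fix x0 d assume d: "l2 (d :: nat \<Rightarrow> real^'d)"
  let ?x = "cl_state A Bu Bd (feedforward h) x0 d"
  have "?x (Suc t) = At *v ?x t + (Bd *v d t - Bu *v (Kv *v h d t))" for t
    unfolding cl_state_Suc feedforward_input
    by (simp add: matrix_vector_mult_diff_rdistrib matrix_vector_mult_diff_distrib matrix_vector_neg
        flip: matrix_vector_mul_assoc)
  then have x: "l2 ?x"
    by (rule l2_forward_recursion[OF decay]) (intro l2_diff l2_matrix d assms)
  moreover have "l2 (\<lambda>t. - (Kx *v ?x t) - Kv *v h d t)"
    by (intro l2_diff l2_minus l2_matrix x assms d)
  ultimately show "l2 ?x \<and> l2 (cl_input A Bu Bd (feedforward h) x0 d)"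
    by (simp add: feedforward_input[abs_def])
qed

lemma feedforward_cost:
  assumes "\<And>d. l2 d \<Longrightarrow> l2 (h d)" and "l2 d"
  shows "cost A Bu Bd Q R (feedforward h) d =
     (\<Sum>t. quad H (Kv *v (costate d t - h d t))) + (\<Sum>t. unavoidable_cost d t)"
  using stabilizing_cost[OF feedforward_stabilizing[OF assms(1)] assms(2)]
  by (simp add: feedforward_input matrix_vector_mult_diff_distrib)

text \<open>The sum has \<open>p + 1\<close> terms: at time \<open>t\<close>, preview \<open>p\<close> gives access to \<open>d(t), \<dots>, d(t + p)\<close>.\<close>
definition preview_costate :: "nat \<Rightarrow> (nat \<Rightarrow> real^'d) \<Rightarrow> nat \<Rightarrow> real^'x" where
  "preview_costate p d t = (\<Sum>k<Suc p. ((*v) (transpose At) ^^ k) (X *v (Bd *v d (t + k))))"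

lemma preview_controller_feedforward: "preview_controller p (feedforward (preview_costate p))"
  unfolding preview_controller_def
proof (intro allI impI)
  fix xs :: "(real^'x) list" and d d' :: "nat \<Rightarrow> real^'d"
  assume a: "xs \<noteq> [] \<and> (\<forall>s<length xs + p. d s = d' s)"
  have "length xs - 1 + k < length xs + p" if "k < Suc p" for k
    using a that by (cases xs) auto
  then have "preview_costate p d (length xs - 1) = preview_costate p d' (length xs - 1)"
    unfolding preview_costate_def using a by (intro sum.cong) auto
  then show "feedforward (preview_costate p) xs d = feedforward (preview_costate p) xs d'"
    by (simp add: feedforward_def)
qed

lemma preview_error:
  assumes "l2 d"
  shows "costate d t - preview_costate p d t = ((*v) (transpose At) ^^ Suc p) (costate d (t + Suc p))"
  using discounted_future_split[OF decay' l2_matrix[OF l2_matrix[OF assms]], of X Bd t "Suc p"]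
  by (simp add: costate_def preview_costate_def del: funpow.simps sum.lessThan_Suc)

lemma preview_error_l2:
  assumes "l2 d"
  shows "l2 (\<lambda>t. costate d t - preview_costate p d t)"
    and "l2_norm_sq (\<lambda>t. costate d t - preview_costate p d t) \<le> (C * \<rho> ^ Suc p)\<^sup>2 * l2_norm_sq (costate d)"
proof -
  have bd: "norm (costate d t - preview_costate p d t) \<le> (C * \<rho> ^ Suc p) * norm (costate d (t + Suc p))" for t
    unfolding preview_error[OF assms] using decay' unfolding power_bounded_def by blast
  note sh = l2_shift[OF costate_l2[OF assms], of "Suc p"]
  note b = l2_norm_bounded[OF sh(1) bd]
  show "l2 (\<lambda>t. costate d t - preview_costate p d t)" by (rule b(1))
  show "l2_norm_sq (\<lambda>t. costate d t - preview_costate p d t) \<le> (C * \<rho> ^ Suc p)\<^sup>2 * l2_norm_sq (costate d)"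
    by (rule order_trans[OF b(2) mult_left_mono[OF sh(2)]]) simp
qed

lemma preview_costate_l2: "l2 d \<Longrightarrow> l2 (preview_costate p d)"
  using l2_diff[OF costate_l2 preview_error_l2(1), of d d p] by simp

text \<open>The loss is written as a square so that it can be added to a bound \<open>\<gamma>\<close> before squaring:
  \<open>\<gamma>\<^sup>2 + (E \<rho>\<^sup>p)\<^sup>2 \<le> (\<gamma> + E \<rho>\<^sup>p)\<^sup>2\<close>.\<close>
lemma preview_cost_bound:
  obtains E where "0 \<le> E" "\<And>p d. l2 d \<Longrightarrow>
    cost A Bu Bd Q R (feedforward (preview_costate p)) d
      \<le> (\<Sum>t. unavoidable_cost d t) + (E * \<rho> ^ p)\<^sup>2 * l2_norm_sq d"
proof -
  obtain G where G: "0 \<le> G" "\<And>d. l2 d \<Longrightarrow> l2_norm_sq (costate d) \<le> G * l2_norm_sq d"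
    using costate_bound by blast
  let ?W = "transpose Kv ** H ** Kv"
  obtain L where L: "0 \<le> L" "\<And>v. \<bar>quad ?W v\<bar> \<le> L * (norm v)\<^sup>2" using quad_bound[of ?W] by blast
  define E where "E = sqrt (L * (C * \<rho>)\<^sup>2 * G)"
  have E2: "(E * \<rho> ^ p)\<^sup>2 = L * ((C * \<rho> ^ Suc p)\<^sup>2 * G)" for p
    using L(1) G(1) by (simp add: E_def power_mult_distrib real_sqrt_pow2)
  have "cost A Bu Bd Q R (feedforward (preview_costate p)) d
      \<le> (\<Sum>t. unavoidable_cost d t) + (E * \<rho> ^ p)\<^sup>2 * l2_norm_sq d" if d: "l2 d" for p d
  proof -
    let ?r = "\<lambda>t. costate d t - preview_costate p d t"
    have "(\<Sum>t. quad H (Kv *v ?r t)) = (\<Sum>t. quad ?W (?r t))" by (simp add: quad_congruence)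
    also have "\<dots> \<le> L * l2_norm_sq ?r" by (rule quad_suminf_bound[OF L(2) preview_error_l2(1)[OF d]])
    also have "\<dots> \<le> L * ((C * \<rho> ^ Suc p)\<^sup>2 * (G * l2_norm_sq d))"
      by (intro mult_left_mono[OF order_trans[OF preview_error_l2(2)[OF d] mult_left_mono[OF G(2)[OF d]]]] L(1)) simp
    finally show ?thesis
      unfolding E2 using feedforward_cost[OF preview_costate_l2 d] by (simp add: mult.assoc)
  qed
  then show ?thesis using L G by (intro that[of E]) (auto simp: E_def)
qed

lemma optimal_cost:
  assumes "l2 d"
  shows "cost A Bu Bd Q R (feedforward costate) d = (\<Sum>t. unavoidable_cost d t)"
  using feedforward_cost[OF costate_l2 assms] by simp

end

lemma l2_norm_sq_pos:
  assumes "l2 d" "d \<noteq> (\<lambda>t. 0)"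
  shows "0 < l2_norm_sq d"
proof -
  obtain t where "d t \<noteq> 0" using assms(2) by auto
  then show ?thesis using assms(1) unfolding l2_norm_sq_def l2_def
    by (intro suminf_pos2[where i = t]) auto
qed

theorem theorem4:
  fixes A :: "real^'nx^'nx"
    and Bu :: "real^'nu^'nx"
    and Bd :: "real^'nd^'nx"
    and Q :: "real^'nx^'nx"
    and R :: "real^'nu^'nu"
  assumes "psd Q" and "pd R"
    and "stabilizable A Bu"
    and "invertible A"
    and "\<And>z. cmod z = 1 \<Longrightarrow> \<not> unobservable_mode A Q z"
  shows "(\<lambda>p. \<gamma>_preview A Bu Bd Q R p) \<longlonglongrightarrow> \<gamma>_nc A Bu Bd Q R"
proof -
  define X where "X = dare_X A Bu Q R"
  have "\<exists>!X. stabilizing_dare_solution A Bu Q R X"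
    using stabilizing_dare_solution_exists[OF assms(1-3,5)] stabilizing_dare_solution_unique[OF assms(1,2)]
    by blast
  then have "stabilizing_dare_solution A Bu Q R X"
    unfolding X_def dare_X_def by (rule theI')
  then have X: "psd X" "riccati A Bu Q R X = X" "schur (A - Bu ** gain_x A Bu R X)"
    by (auto simp: stabilizing_dare_solution_iff)
  obtain C \<rho> where decay: "power_bounded (A - Bu ** gain_x A Bu R X) C \<rho>"
    using schur_imp_power_bounded[OF X(3)] by blast
  then have \<rho>: "0 < \<rho>" "\<rho> < 1" by (auto simp: power_bounded_def)
  interpret riccati_loop A Bu Bd Q R X C \<rho>
    by unfold_locales (fact assms(2) X(1,2) decay)+
  have K_nc: "K_nc A Bu Bd Q R = feedforward costate"
    by (simp add: K_nc_def feedforward_def costate_def discounted_future_def X_def[symmetric] Let_def)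
  define P where "P p = {\<gamma>. 0 < \<gamma> \<and>
       (\<exists>K. preview_controller p K \<and> stabilizing A Bu Bd K \<and> hinf_bound A Bu Bd Q R K \<gamma>)}" for p
  define S where "S = {\<gamma>. 0 < \<gamma> \<and> hinf_bound A Bu Bd Q R (K_nc A Bu Bd Q R) \<gamma>}"
  have bdd: "bdd_below S" "bdd_below (P p)" for p
    by (auto simp: S_def P_def intro!: bdd_belowI[of _ 0])
  have P_S: "P p \<subseteq> S" for p
  proof
    fix \<gamma> assume "\<gamma> \<in> P p"
    then obtain K where K: "0 < \<gamma>" "stabilizing A Bu Bd K" "hinf_bound A Bu Bd Q R K \<gamma>"
      by (auto simp: P_def)
    have "hinf_bound A Bu Bd Q R (K_nc A Bu Bd Q R) \<gamma>"
      unfolding hinf_bound_def K_nc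
    proof (intro allI impI, elim conjE)
      fix d :: "nat \<Rightarrow> real^'nd" assume d: "l2 d" "d \<noteq> (\<lambda>t. 0)"
      have "cost A Bu Bd Q R (feedforward costate) d \<le> cost A Bu Bd Q R K d"
        unfolding optimal_cost[OF d(1)] by (rule unavoidable_cost_le[OF K(2) d(1)])
      also have "\<dots> < \<gamma>\<^sup>2 * l2_norm_sq d" using K(3) d by (simp add: hinf_bound_def)
      finally show "cost A Bu Bd Q R (feedforward costate) d < \<gamma>\<^sup>2 * l2_norm_sq d" .
    qed
    then show "\<gamma> \<in> S" using K(1) by (simp add: S_def)
  qed
  obtain L where L: "0 \<le> L" "\<And>d. l2 d \<Longrightarrow> (\<Sum>t. unavoidable_cost d t) \<le> L * l2_norm_sq d"
    using unavoidable_cost_bound by blast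
  have "sqrt (L + 1) \<in> S"
    unfolding S_def hinf_bound_def K_nc
  proof (intro CollectI conjI allI impI, simp add: L(1) add_nonneg_pos, elim conjE)
    fix d :: "nat \<Rightarrow> real^'nd" assume d: "l2 d" "d \<noteq> (\<lambda>t. 0)"
    show "cost A Bu Bd Q R (feedforward costate) d < (sqrt (L + 1))\<^sup>2 * l2_norm_sq d"
      using L(1) L(2)[OF d(1)] l2_norm_sq_pos[OF d] by (simp add: optimal_cost[OF d(1)] distrib_right)
  qed
  then have S: "S \<noteq> {}" by blast
  obtain E where E: "0 \<le> E" "\<And>p d. l2 d \<Longrightarrow>
    cost A Bu Bd Q R (feedforward (preview_costate p)) d
      \<le> (\<Sum>t. unavoidable_cost d t) + (E * \<rho> ^ p)\<^sup>2 * l2_norm_sq d"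
    using preview_cost_bound by blast
  have S_P: "\<gamma> + E * \<rho> ^ p \<in> P p" if "\<gamma> \<in> S" for \<gamma> p
  proof -
    have \<gamma>: "0 < \<gamma>" "hinf_bound A Bu Bd Q R (feedforward costate) \<gamma>" using that by (auto simp: S_def K_nc)
    have e: "0 \<le> E * \<rho> ^ p" using E(1) \<rho> by simp
    have "hinf_bound A Bu Bd Q R (feedforward (preview_costate p)) (\<gamma> + E * \<rho> ^ p)"
      unfolding hinf_bound_def
    proof (intro allI impI, elim conjE)
      fix d :: "nat \<Rightarrow> real^'nd" assume d: "l2 d" "d \<noteq> (\<lambda>t. 0)"
      have "cost A Bu Bd Q R (feedforward (preview_costate p)) d
          \<le> (\<Sum>t. unavoidable_cost d t) + (E * \<rho> ^ p)\<^sup>2 * l2_norm_sq d" by (rule E(2)[OF d(1)])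
      also have "\<dots> < \<gamma>\<^sup>2 * l2_norm_sq d + (E * \<rho> ^ p)\<^sup>2 * l2_norm_sq d"
        using \<gamma>(2) d by (simp add: hinf_bound_def optimal_cost)
      also have "\<dots> = (\<gamma>\<^sup>2 + (E * \<rho> ^ p)\<^sup>2) * l2_norm_sq d" by (simp add: distrib_right)
      also have "\<dots> \<le> (\<gamma> + E * \<rho> ^ p)\<^sup>2 * l2_norm_sq d"
        using \<gamma>(1) e l2_norm_sq_pos[OF d] by (intro mult_right_mono) (auto simp: power2_sum)
      finally show "cost A Bu Bd Q R (feedforward (preview_costate p)) d < (\<gamma> + E * \<rho> ^ p)\<^sup>2 * l2_norm_sq d" .
    qed
    then show ?thesis
      using preview_controller_feedforward feedforward_stabilizing[OF preview_costate_l2] \<gamma>(1) e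
      unfolding P_def by (intro CollectI conjI exI) auto
  qed
  have lower: "Inf S \<le> Inf (P p)" for p
    using S S_P P_S bdd by (intro cInf_superset_mono) blast+
  have upper: "Inf (P p) \<le> Inf S + E * \<rho> ^ p" for p
  proof -
    have "Inf (P p) - E * \<rho> ^ p \<le> \<gamma>" if "\<gamma> \<in> S" for \<gamma>
      using cInf_lower[OF S_P[OF that, of p] bdd(2)] by simp
    from cInf_greatest[OF S this] show ?thesis by simp
  qed
  have "(\<lambda>p. Inf S + E * \<rho> ^ p) \<longlonglongrightarrow> Inf S + E * 0"
    using \<rho> by (intro tendsto_intros LIMSEQ_power_zero) auto
  then have lim: "(\<lambda>p. Inf S + E * \<rho> ^ p) \<longlonglongrightarrow> Inf S" by simp
  have "(\<lambda>p. Inf (P p)) \<longlonglongrightarrow> Inf S"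
    by (rule tendsto_sandwich[OF _ _ tendsto_const lim]) (use lower upper in auto)
  then show ?thesis by (simp add: \<gamma>_preview_def \<gamma>_nc_def P_def S_def)
qed

end
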